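(* Let $\mathcal{M}$ be a graph matroid family that is $1$-extendable. Then $\mathcal{M}$ has the Lovász-Yemini property (and hence the Whitney property).
   Context: All graphs are finite and simple and have no isolated vertices. A graph matroid family $\mathcal{M}$ assigns to every graph $G$ a matroid $\mathcal{M}(G)$ on $E(G)$ such that (i) every graph isomorphism $V(G)\to V(H)$ induces an isomorphism $\mathcal{M}(G)\to\mathcal{M}(H)$, and (ii) for every subgraph $H$ of $G$, $\mathcal{M}(H)$ is the restriction of $\mathcal{M}(G)$ to $E(H)$. Let $r(G)$ be the rank of $\mathcal{M}(G)$. $G$ is $\mathcal{M}$-independent if $r(G)=|E(G)|$; an $\mathcal{M}$-circuit is an $\mathcal{M}$-dependent graph $G$ with $G-e$ $\mathcal{M}$-independent for all $e\in E(G)$; $G$ is $\mathcal{M}$-rigid if $r(G)=r(K_{V(G)})$. $\mathcal{M}$ is nontrivial if some graph is $\mathcal{M}$-dependent; its dimensionality is then $d=\min\{\delta-1\}$ over minimum degrees $\delta$ of $\mathcal{M}$-circuits. $\mathcal{M}$ is unbounded if $r(K_n)$ is unbounded. For a positive integer $d$, the $d$-dimensional edge split operation replaces an edge $uv$ of a graph by a new vertex adjacent to $u$, $v$, and $d-1$ other existing vertices. $\mathcal{M}$ is $1$-extendable if it is nontrivial, unbounded, has dimensionality $d\ge1$, and the $d$-dimensional edge split operation preserves $\mathcal{M}$-independence. A graph $G$ is $\mathcal{M}$-reconstructible if every matroid isomorphism $\psi:E(G)\to E(H)$ between $\mathcal{M}(G)$ and $\mathcal{M}(H)$, for any graph $H$,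 is induced by a graph isomorphism $\varphi$ (i.e. $\psi(uv)=\varphi(u)\varphi(v)$). $\mathcal{M}$ has the Lovász-Yemini property if for some nonnegative integer $c$ every $c$-connected graph is $\mathcal{M}$-rigid, and the Whitney property if for some $c$ every $c$-connected graph is $\mathcal{M}$-reconstructible. *)

theory Defs
  imports Main
begin

text \<open>Graphs: a finite simple graph without isolated vertices is represented by its
  edge set, a finite set of two-element vertex sets. Its vertex set is the union of its edges.\<close>

definition graph :: "'v set set \<Rightarrow> bool" where
  "graph G \<longleftrightarrow> finite G \<and> (\<forall>e\<in>G. card e = 2)"

definition verts :: "'v set set \<Rightarrow> 'v set" where
  "verts G = \<Union>G"

definition complete :: "'v set \<Rightarrow> 'v set set" where
  "complete V = {{u, v} | u v. u \<in> V \<and> v \<in> V \<and> u \<noteq> v}"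

definition deg :: "'v set set \<Rightarrow> 'v \<Rightarrow> nat" where
  "deg G v = card {e \<in> G. v \<in> e}"

definition mindeg :: "'v set set \<Rightarrow> nat" where
  "mindeg G = Min (deg G ` verts G)"

definition graph_iso :: "('v \<Rightarrow> 'v) \<Rightarrow> 'v set set \<Rightarrow> 'v set set \<Rightarrow> bool" where
  "graph_iso \<phi> G H \<longleftrightarrow> bij_betw \<phi> (verts G) (verts H) \<and>
     (\<forall>u\<in>verts G. \<forall>v\<in>verts G. {u, v} \<in> G \<longleftrightarrow> {\<phi> u, \<phi> v} \<in> H)"

text \<open>Connectivity (vertex connectivity, Diestel convention).\<close>

definition connected_on :: "'v set \<Rightarrow> 'v set set \<Rightarrow> bool" where
  "connected_on V E \<longleftrightarrow> V \<noteq> {} \<and>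
     (\<forall>x\<in>V. \<forall>y\<in>V. (x, y) \<in> {(a, b). {a, b} \<in> E}\<^sup>*)"

definition k_connected :: "'v set set \<Rightarrow> nat \<Rightarrow> bool" where
  "k_connected G k \<longleftrightarrow> card (verts G) \<ge> k + 1 \<and>
     (\<forall>X \<subseteq> verts G. card X < k \<longrightarrow> connected_on (verts G - X) {e \<in> G. e \<inter> X = {}})"

text \<open>Matroids on a finite ground set, given by their independence predicate.\<close>

definition matroid :: "'e set \<Rightarrow> ('e set \<Rightarrow> bool) \<Rightarrow> bool" where
  "matroid X I \<longleftrightarrow> finite X \<and> I {} \<and> (\<forall>A. I A \<longrightarrow> A \<subseteq> X) \<and>
     (\<forall>A B. I B \<and> A \<subseteq> B \<longrightarrow> I A) \<and>
     (\<forall>A B. I A \<and> I B \<and> card A < card B \<longrightarrow> (\<exists>x\<in>B - A. I (insert x A)))"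

text \<open>A graph matroid family: \<open>M G\<close> is the independence predicate of the matroid
  \<open>\<M>(G)\<close> on \<open>E(G)\<close>. A subgraph of a graph without isolated vertices is given by a subset
  of its edges.\<close>

definition graph_matroid_family :: "('v set set \<Rightarrow> 'v set set \<Rightarrow> bool) \<Rightarrow> bool" where
  "graph_matroid_family M \<longleftrightarrow>
     (\<forall>G. graph G \<longrightarrow> matroid G (M G)) \<and>
     (\<forall>G H \<phi>. graph G \<and> graph H \<and> graph_iso \<phi> G H \<longrightarrow>
        (\<forall>F. F \<subseteq> G \<longrightarrow> (M G F \<longleftrightarrow> M H ((`) \<phi> ` F)))) \<and>
     (\<forall>G H. graph G \<and> H \<subseteq> G \<longrightarrow> (\<forall>F. M H F \<longleftrightarrow> F \<subseteq> H \<and> M G F))"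

definition rank :: "('v set set \<Rightarrow> 'v set set \<Rightarrow> bool) \<Rightarrow> 'v set set \<Rightarrow> nat" where
  "rank M G = Max (card ` {F. F \<subseteq> G \<and> M G F})"

definition indep :: "('v set set \<Rightarrow> 'v set set \<Rightarrow> bool) \<Rightarrow> 'v set set \<Rightarrow> bool" where
  "indep M G \<longleftrightarrow> rank M G = card G"

definition circuit :: "('v set set \<Rightarrow> 'v set set \<Rightarrow> bool) \<Rightarrow> 'v set set \<Rightarrow> bool" where
  "circuit M C \<longleftrightarrow> graph C \<and> \<not> indep M C \<and> (\<forall>e\<in>C. indep M (C - {e}))"

definition rigid :: "('v set set \<Rightarrow> 'v set set \<Rightarrow> bool) \<Rightarrow> 'v set set \<Rightarrow> bool" where
  "rigid M G \<longleftrightarrow> rank M G = rank M (complete (verts G))"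

definition nontrivial :: "('v set set \<Rightarrow> 'v set set \<Rightarrow> bool) \<Rightarrow> bool" where
  "nontrivial M \<longleftrightarrow> (\<exists>G. graph G \<and> \<not> indep M G)"

definition dimensionality :: "('v set set \<Rightarrow> 'v set set \<Rightarrow> bool) \<Rightarrow> nat" where
  "dimensionality M = (LEAST d. \<exists>C. circuit M C \<and> d = mindeg C - 1)"

definition unbounded :: "('v set set \<Rightarrow> 'v set set \<Rightarrow> bool) \<Rightarrow> bool" where
  "unbounded M \<longleftrightarrow> (\<forall>k. \<exists>V. finite V \<and> rank M (complete V) > k)"

text \<open>d-dimensional edge split: delete edge uv, add new vertex w adjacent to u, v and the
  vertices of S (d-1 further existing vertices).\<close>

definition edge_split :: "'v set set \<Rightarrow> 'v \<Rightarrow> 'v \<Rightarrow> 'v \<Rightarrow> 'v set \<Rightarrow> 'v set set" where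
  "edge_split G u v w S = (G - {{u, v}}) \<union> (\<lambda>x. {w, x}) ` ({u, v} \<union> S)"

definition one_extendable :: "('v set set \<Rightarrow> 'v set set \<Rightarrow> bool) \<Rightarrow> bool" where
  "one_extendable M \<longleftrightarrow> nontrivial M \<and> unbounded M \<and> dimensionality M \<ge> 1 \<and>
     (\<forall>G u v w S. graph G \<and> indep M G \<and> {u, v} \<in> G \<and> w \<notin> verts G \<and>
        S \<subseteq> verts G - {u, v} \<and> card S = dimensionality M - 1 \<longrightarrow>
        indep M (edge_split G u v w S))"

definition reconstructible :: "('v set set \<Rightarrow> 'v set set \<Rightarrow> bool) \<Rightarrow> 'v set set \<Rightarrow> bool" where
  "reconstructible M G \<longleftrightarrow>
     (\<forall>H \<psi>. graph H \<and> bij_betw \<psi> G H \<and> (\<forall>F. F \<subseteq> G \<longrightarrow> (M G F \<longleftrightarrow> M H (\<psi> ` F))) \<longrightarrow>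
        (\<exists>\<phi>. graph_iso \<phi> G H \<and> (\<forall>e\<in>G. \<psi> e = \<phi> ` e)))"

definition lovasz_yemini :: "('v set set \<Rightarrow> 'v set set \<Rightarrow> bool) \<Rightarrow> bool" where
  "lovasz_yemini M \<longleftrightarrow> (\<exists>c. \<forall>G. graph G \<and> k_connected G c \<longrightarrow> rigid M G)"

definition whitney :: "('v set set \<Rightarrow> 'v set set \<Rightarrow> bool) \<Rightarrow> bool" where
  "whitney M \<longleftrightarrow> (\<exists>c. \<forall>G. graph G \<and> k_connected G c \<longrightarrow> reconstructible M G)"

end

theory Submission
  imports Defs
begin

text \<open>
  Let \<open>d\<close> be the dimensionality. Circuits have minimum degree at least \<open>d + 1\<close>, so adding a vertex
  of degree \<open>m\<close> raises the rank by at least \<open>min d m\<close>; by 1-extendability the gain is \<open>d + 1\<close> if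
  the vertex has degree at least \<open>d + 1\<close> and two of its neighbours are nonadjacent in a closed graph.
  A circuit with a vertex of degree exactly \<open>d + 1\<close> shows that the rank of the complete graph on
  \<open>n\<close> vertices is \<open>d n\<close> up to an additive constant, for large \<open>n\<close>.

  Rigidity: it suffices that a highly connected closed graph is complete. A simplicial vertex can be
  removed by induction. If there is none, build the graph from a small dominating set so that a
  fixed proportion of the vertices gains \<open>d + 1\<close>; the rank then exceeds that of the complete graph.

  Reconstruction: deleting a vertex incident with both parts of an edge partition \<open>A, B\<close> of \<open>G\<close>
  lowers \<open>rk A + rk B - rk G\<close>, so the matroid of a highly connected graph has no
  partition with small connectivity and two parts of large rank. Hence any graph \<open>H\<close> with the same
  matroid is highly connected, thus rigid, with as many vertices as \<open>G\<close>. Applied to \<open>G - v\<close>, this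
  shows that the image of \<open>G - v\<close> misses a vertex of \<open>H\<close>, so stars are mapped to stars.
\<close>

section \<open>Rank in finitary matroids\<close>

text \<open>No ground set is fixed, so that a single independence predicate can serve all graphs at
  once; ranks are accordingly only used for finite sets.\<close>

locale finitary_matroid =
  fixes I :: "'e set \<Rightarrow> bool"
  assumes I_finite: "I F \<Longrightarrow> finite F"
    and I_empty: "I {}"
    and I_subset: "I B \<Longrightarrow> A \<subseteq> B \<Longrightarrow> I A"
    and I_augment: "I A \<Longrightarrow> I B \<Longrightarrow> card A < card B \<Longrightarrow> \<exists>x\<in>B - A. I (insert x A)"
begin

definition rk :: "'e set \<Rightarrow> nat" where
  "rk X = Max (card ` {F. F \<subseteq> X \<and> I F})"

lemma card_le_rk:
  assumes "finite X" "F \<subseteq> X" "I F"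
  shows "card F \<le> rk X"
proof -
  have "finite {F. F \<subseteq> X \<and> I F}"
    by (rule finite_subset[of _ "Pow X"]) (use assms in auto)
  then show ?thesis
    unfolding rk_def using assms by (intro Max_ge) auto
qed

lemma basis_exists:
  assumes "finite X"
  obtains B where "B \<subseteq> X" "I B" "card B = rk X"
proof -
  have "finite {F. F \<subseteq> X \<and> I F}"
    by (rule finite_subset[of _ "Pow X"]) (use assms in auto)
  moreover have "{F. F \<subseteq> X \<and> I F} \<noteq> {}"
    using I_empty by auto
  ultimately have "rk X \<in> card ` {F. F \<subseteq> X \<and> I F}"
    unfolding rk_def by (intro Max_in) auto
  then show ?thesis
    using that by auto
qed

lemma extend_to_basis:
  assumes "finite X" "A \<subseteq> X" "I A"
  obtains B where "A \<subseteq> B" "B \<subseteq> X" "I B" "card B = rk X"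
proof -
  have "\<exists>B. A \<subseteq> B \<and> B \<subseteq> X \<and> I B \<and> card B = rk X"
    using assms(2,3)
  proof (induction "rk X - card A" arbitrary: A rule: less_induct)
    case less
    show ?case
    proof (cases "card A < rk X")
      case True
      obtain B0 where B0: "B0 \<subseteq> X" "I B0" "card B0 = rk X"
        using basis_exists[OF assms(1)] .
      obtain x where x: "x \<in> B0 - A" "I (insert x A)"
        using I_augment[OF less.prems(2) B0(2)] True B0(3) by auto
      have "card (insert x A) = Suc (card A)"
        using x I_finite[OF less.prems(2)] by simp
      with True have "rk X - card (insert x A) < rk X - card A"
        by simp
      then have "\<exists>B. insert x A \<subseteq> B \<and> B \<subseteq> X \<and> I B \<and> card B = rk X"
        using less.hyps[of "insert x A"] less.prems x B0 by auto
      then show ?thesis by auto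
    next
      case False
      then have "card A = rk X"
        using card_le_rk[OF assms(1) less.prems] by simp
      then show ?thesis using less.prems by auto
    qed
  qed
  then show ?thesis using that by auto
qed

lemma rk_mono:
  assumes "X \<subseteq> Y" "finite Y"
  shows "rk X \<le> rk Y"
proof -
  obtain B where "B \<subseteq> X" "I B" "card B = rk X"
    using basis_exists[of X] assms finite_subset by blast
  then show ?thesis using card_le_rk[of Y B] assms by auto
qed

lemma rk_le_card: "finite X \<Longrightarrow> rk X \<le> card X"
  by (metis basis_exists card_mono)

lemma rk_empty [simp]: "rk {} = 0"
  using rk_le_card[of "{}"] by simp

lemma I_iff_rk:
  assumes "finite X"
  shows "I X \<longleftrightarrow> rk X = card X"
proof
  assume "I X"
  then show "rk X = card X"
    using card_le_rk[of X X] rk_le_card[OF assms] assms by simp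
next
  assume "rk X = card X"
  then show "I X"
    by (metis assms basis_exists card_subset_eq)
qed

lemma rk_submodular:
  assumes "finite X" "finite Y"
  shows "rk (X \<union> Y) + rk (X \<inter> Y) \<le> rk X + rk Y"
proof -
  obtain B0 where B0: "B0 \<subseteq> X \<inter> Y" "I B0" "card B0 = rk (X \<inter> Y)"
    using basis_exists[of "X \<inter> Y"] assms by auto
  obtain B where B: "B0 \<subseteq> B" "B \<subseteq> X \<union> Y" "I B" "card B = rk (X \<union> Y)"
    using extend_to_basis[of "X \<union> Y" B0] B0 assms by blast
  have fB: "finite B" by (rule I_finite[OF B(3)])
  have "card (B \<inter> X) + card (B \<inter> Y) = card B + card (B \<inter> X \<inter> Y)"
  proof -
    have "(B \<inter> X) \<union> (B \<inter> Y) = B" "(B \<inter> X) \<inter> (B \<inter> Y) = B \<inter> X \<inter> Y"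
      using B by auto
    then show ?thesis
      using card_Un_Int[of "B \<inter> X" "B \<inter> Y"] fB by simp
  qed
  moreover have "card (B \<inter> X) \<le> rk X" "card (B \<inter> Y) \<le> rk Y"
    using card_le_rk[of X "B \<inter> X"] card_le_rk[of Y "B \<inter> Y"] I_subset[OF B(3)] assms by auto
  moreover have "card B0 \<le> card (B \<inter> X \<inter> Y)"
    using B0 B fB by (intro card_mono) auto
  ultimately show ?thesis using B B0 by simp
qed

lemma rk_Un_le:
  assumes "finite X" "finite Y"
  shows "rk (X \<union> Y) \<le> rk X + card Y"
  using rk_submodular[OF assms] rk_le_card[OF assms(2)] by simp

lemma rk_submodular_subset:
  assumes "finite X" "finite Y" "Z \<subseteq> X \<inter> Y" "W \<subseteq> X \<union> Y"
  shows "rk W + rk Z \<le> rk X + rk Y"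
  using rk_submodular[OF assms(1,2)] rk_mono[OF assms(3)] rk_mono[OF assms(4)] assms(1,2)
  by simp

lemma rk_insert_le: "finite X \<Longrightarrow> rk (insert x X) \<le> Suc (rk X)"
  using rk_Un_le[of X "{x}"] by simp

lemma rk_insert_span_mono:
  assumes "finite Y" "X \<subseteq> Y" "rk (insert x X) = rk X"
  shows "rk (insert x Y) = rk Y"
proof -
  have "rk (insert x Y) + rk X \<le> rk Y + rk (insert x X)"
    using assms finite_subset by (intro rk_submodular_subset) auto
  moreover have "rk Y \<le> rk (insert x Y)"
    using assms by (intro rk_mono) auto
  ultimately show ?thesis using assms by simp
qed

lemma rk_span:
  assumes "finite X" "finite Y" "\<And>y. y \<in> Y \<Longrightarrow> rk (insert y X) = rk X"
  shows "rk (X \<union> Y) = rk X"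
  using assms(2,3)
proof (induction Y)
  case (insert y Y)
  have "rk (insert y (X \<union> Y)) = rk (X \<union> Y)"
    by (rule rk_insert_span_mono[of _ X]) (use insert assms(1) in auto)
  then show ?case using insert by simp
qed simp

text \<open>The form in which circuits enter rank computations: if dropping \<open>e\<close> cures
  the dependence of \<open>C\<close>, then \<open>e\<close> is spanned by \<open>C - {e}\<close>,
  hence by every finite superset of it.\<close>

lemma rk_circuit_span:
  assumes "finite X" "C - {e} \<subseteq> X" "\<not> I C" "I (C - {e})"
  shows "rk (insert e X) = rk X"
proof -
  have eC: "e \<in> C" using assms(3,4) by (metis Diff_empty Diff_insert0)
  have fC: "finite C" using I_finite[OF assms(4)] by simp
  have "rk C \<noteq> card C" using I_iff_rk[OF fC] assms(3) by simp
  then have "rk C \<le> card (C - {e})"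
    using rk_le_card[OF fC] eC fC by simp
  also have "\<dots> \<le> rk (C - {e})"
    using card_le_rk[of "C - {e}" "C - {e}"] assms(4) fC by simp
  finally have "rk (insert e (C - {e})) = rk (C - {e})"
    using rk_mono[of "C - {e}" C] fC eC by (simp add: insert_absorb)
  then show ?thesis
    using rk_insert_span_mono[of X "C - {e}" e] assms by simp
qed

lemma circuit_exists:
  assumes "finite X" "\<not> I X"
  obtains C where "C \<subseteq> X" "\<not> I C" "\<And>e. e \<in> C \<Longrightarrow> I (C - {e})"
proof -
  have "\<exists>C. C \<subseteq> X \<and> \<not> I C \<and> (\<forall>e\<in>C. I (C - {e}))"
    using assms
  proof (induction X rule: finite_psubset_induct)
    case (psubset X)
    show ?case
    proof (cases "\<forall>e\<in>X. I (X - {e})")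
      case False
      then obtain e where e: "e \<in> X" "\<not> I (X - {e})" by auto
      then obtain C where "C \<subseteq> X - {e}" "\<not> I C" "\<forall>e\<in>C. I (C - {e})"
        using psubset.IH[of "X - {e}"] by auto
      then show ?thesis by blast
    qed (use psubset in auto)
  qed
  then show ?thesis using that by auto
qed

text \<open>The local connectivity is \<open>rk A + rk B - rk (A \<union> B)\<close>; subtraction is avoided.\<close>

lemma local_connectivity_mono:
  assumes "finite A'" "finite B'" "A \<subseteq> A'" "B \<subseteq> B'"
  shows "rk A + rk B + rk (A' \<union> B') \<le> rk A' + rk B' + rk (A \<union> B)"
proof -
  have fin: "finite A" "finite B" using assms finite_subset by auto
  have "rk (A' \<union> B) + rk A \<le> rk A' + rk (A \<union> B)"
    using assms fin by (intro rk_submodular_subset) auto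
  moreover have "rk (A' \<union> B') + rk B \<le> rk (A' \<union> B) + rk B'"
    using assms fin by (intro rk_submodular_subset) auto
  ultimately show ?thesis by simp
qed

end

section \<open>Graphs and connectivity\<close>

text \<open>Vertex deletion. As graphs are edge sets, a vertex whose neighbours all lie in
  \<open>X\<close> disappears too; \<open>verts_avoid\<close> excludes this under high
  connectivity.\<close>

definition avoid :: "'v set set \<Rightarrow> 'v set \<Rightarrow> 'v set set" where
  "avoid G X = {e \<in> G. e \<inter> X = {}}"

definition nbrs :: "'v set set \<Rightarrow> 'v \<Rightarrow> 'v set" where
  "nbrs G v = {u. {v, u} \<in> G}"

lemma avoid_subset: "avoid G X \<subseteq> G"
  by (auto simp: avoid_def)

lemma avoid_avoid: "avoid (avoid G X) Y = avoid G (X \<union> Y)"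
  by (auto simp: avoid_def)

lemma avoid_empty [simp]: "avoid G {} = G"
  by (auto simp: avoid_def)

lemma verts_avoid_subset: "verts (avoid G X) \<subseteq> verts G - X"
  by (auto simp: avoid_def verts_def)

lemma verts_mono: "F \<subseteq> G \<Longrightarrow> verts F \<subseteq> verts G"
  by (auto simp: verts_def)

lemma graph_subset: "graph G \<Longrightarrow> F \<subseteq> G \<Longrightarrow> graph F"
  by (auto simp: graph_def finite_subset)

lemma graph_avoid: "graph G \<Longrightarrow> graph (avoid G X)"
  using graph_subset avoid_subset by blast

lemma graph_Un: "graph G \<Longrightarrow> graph H \<Longrightarrow> graph (G \<union> H)"
  by (auto simp: graph_def)

lemma graph_finite: "graph G \<Longrightarrow> finite G"
  by (simp add: graph_def)

lemma finite_verts: "graph G \<Longrightarrow> finite (verts G)"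
  unfolding graph_def verts_def by (metis card.infinite finite_Union zero_neq_numeral)

lemma graph_edgeE:
  assumes "graph G" "e \<in> G" "v \<in> e"
  obtains u where "u \<noteq> v" "e = {v, u}"
proof -
  have "card e = 2" using assms by (auto simp: graph_def)
  then obtain a b where "e = {a, b}" "a \<noteq> b" by (auto simp: card_2_iff)
  then show ?thesis using assms(3) that[of a] that[of b] by (auto simp: insert_commute)
qed

lemma graph_edge_neq: "graph G \<Longrightarrow> {u, v} \<in> G \<Longrightarrow> u \<noteq> v"
  by (auto simp: graph_def)

lemma edge_in_verts: "{u, v} \<in> G \<Longrightarrow> u \<in> verts G \<and> v \<in> verts G"
  by (auto simp: verts_def)

lemma nbrs_subset: "graph G \<Longrightarrow> nbrs G v \<subseteq> verts G - {v}"
  by (auto simp: nbrs_def verts_def graph_def)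

lemma finite_nbrs: "graph G \<Longrightarrow> finite (nbrs G v)"
  using nbrs_subset[of G v] finite_verts[of G] finite_subset by blast

lemma verts_eq_nbrs: "graph G \<Longrightarrow> verts G = {v. nbrs G v \<noteq> {}}"
proof -
  assume G: "graph G"
  have "nbrs G v \<noteq> {}" if v: "v \<in> verts G" for v
  proof -
    obtain e where e: "e \<in> G" "v \<in> e" using v by (auto simp: verts_def)
    then obtain u where "e = {v, u}" using graph_edgeE[OF G] by metis
    then show ?thesis using e by (auto simp: nbrs_def)
  qed
  moreover have "v \<in> verts G" if "nbrs G v \<noteq> {}" for v
    using that edge_in_verts[of v _ G] by (auto simp: nbrs_def)
  ultimately show ?thesis by blast
qed

lemma star_eq_nbrs:
  assumes "graph G"
  shows "{e \<in> G. v \<in> e} = (\<lambda>u. {v, u}) ` nbrs G v"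
proof
  show "{e \<in> G. v \<in> e} \<subseteq> (\<lambda>u. {v, u}) ` nbrs G v"
  proof
    fix e assume "e \<in> {e \<in> G. v \<in> e}"
    then have e: "e \<in> G" "v \<in> e" by auto
    then obtain u where "e = {v, u}" by (metis graph_edgeE[OF assms])
    then show "e \<in> (\<lambda>u. {v, u}) ` nbrs G v" using e by (simp add: nbrs_def)
  qed
qed (auto simp: nbrs_def)

lemma inj_on_star: "inj_on (\<lambda>u. {v, u}) A"
  by (auto simp: inj_on_def doubleton_eq_iff)

lemma deg_eq_card_nbrs: "graph G \<Longrightarrow> deg G v = card (nbrs G v)"
  by (simp add: deg_def star_eq_nbrs card_image inj_on_star)

lemma nbrs_avoid: "v \<notin> X \<Longrightarrow> nbrs (avoid G X) v = nbrs G v - X"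
  by (auto simp: nbrs_def avoid_def)

lemma graph_complete:
  assumes "finite V"
  shows "graph (complete V)"
proof -
  have "complete V \<subseteq> Pow V" by (auto simp: complete_def)
  then have "finite (complete V)" using assms finite_subset by blast
  then show ?thesis by (auto simp: graph_def complete_def)
qed

lemma complete_edge_iff: "{u, v} \<in> complete V \<longleftrightarrow> u \<in> V \<and> v \<in> V \<and> u \<noteq> v"
  by (auto simp: complete_def doubleton_eq_iff)

lemma complete_mono: "V \<subseteq> W \<Longrightarrow> complete V \<subseteq> complete W"
  by (auto simp: complete_def)

lemma complete_insert: "v \<notin> V \<Longrightarrow> complete (insert v V) = complete V \<union> (\<lambda>s. {v, s}) ` V"
proof (rule set_eqI)
  fix e assume v: "v \<notin> V"
  show "e \<in> complete (insert v V) \<longleftrightarrow> e \<in> complete V \<union> (\<lambda>s. {v, s}) ` V"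
  proof
    assume "e \<in> complete (insert v V)"
    then obtain a b where e: "e = {a, b}" "a \<in> insert v V" "b \<in> insert v V" "a \<noteq> b"
      by (auto simp: complete_def)
    then consider "a = v" "b \<in> V" | "b = v" "a \<in> V" | "a \<in> V" "b \<in> V" by blast
    then show "e \<in> complete V \<union> (\<lambda>s. {v, s}) ` V"
      using e by cases (auto simp: complete_edge_iff insert_commute)
  next
    assume "e \<in> complete V \<union> (\<lambda>s. {v, s}) ` V"
    then show "e \<in> complete (insert v V)"
      using complete_mono[of V "insert v V"] v by (auto simp: complete_edge_iff)
  qed
qed

lemma avoid_complete: "avoid (complete V) X = complete (V - X)"
  by (auto simp: avoid_def complete_def)

lemma subset_complete:
  assumes "graph G" "verts G \<subseteq> V"
  shows "G \<subseteq> complete V"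
proof
  fix e assume e: "e \<in> G"
  then obtain u v where "e = {u, v}" "u \<noteq> v"
    using assms(1) by (auto simp: graph_def card_2_iff)
  then show "e \<in> complete V"
    using e assms(2) edge_in_verts[of u v G] by (auto simp: complete_edge_iff)
qed

section \<open>Vertex connectivity\<close>

lemma k_connected_iff:
  "k_connected G k \<longleftrightarrow> card (verts G) \<ge> k + 1 \<and>
     (\<forall>X \<subseteq> verts G. card X < k \<longrightarrow> connected_on (verts G - X) (avoid G X))"
  by (simp add: k_connected_def avoid_def)

lemma k_connected_le: "k_connected G k \<Longrightarrow> j \<le> k \<Longrightarrow> k_connected G j"
  by (auto simp: k_connected_iff)

lemma connected_on_mono:
  assumes "connected_on V E" "E \<subseteq> F"
  shows "connected_on V F"
proof -
  have "{(a, b). {a, b} \<in> E}\<^sup>* \<subseteq> {(a, b). {a, b} \<in> F}\<^sup>*"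
    using assms(2) by (intro rtrancl_mono) auto
  then show ?thesis using assms(1) unfolding connected_on_def by blast
qed

lemma k_connected_mono:
  assumes "k_connected G k" "G \<subseteq> H" "verts H = verts G"
  shows "k_connected H k"
  unfolding k_connected_iff
proof (intro conjI allI impI)
  fix X assume "X \<subseteq> verts H" "card X < k"
  then have "connected_on (verts G - X) (avoid G X)"
    using assms by (auto simp: k_connected_iff)
  then show "connected_on (verts H - X) (avoid H X)"
    using connected_on_mono[of _ "avoid G X" "avoid H X"] assms by (auto simp: avoid_def)
qed (use assms in \<open>auto simp: k_connected_iff\<close>)

lemma connected_on_nbr:
  assumes "connected_on V E" "v \<in> V" "z \<in> V" "v \<noteq> z"
  obtains u where "{v, u} \<in> E"
proof -
  have "(v, z) \<in> {(a, b). {a, b} \<in> E}\<^sup>*"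
    using assms by (auto simp: connected_on_def)
  then show ?thesis
    using assms(4) that by (auto elim: converse_rtranclE)
qed

text \<open>Deleting fewer than \<open>k\<close> neighbours of \<open>v\<close> would isolate it,
  although the graph has enough vertices for another one to remain.\<close>

lemma k_connected_deg:
  assumes "graph G" "k_connected G k" "v \<in> verts G"
  shows "k \<le> deg G v"
proof (rule ccontr)
  assume "\<not> k \<le> deg G v"
  then have less: "card (nbrs G v) < k" by (simp add: deg_eq_card_nbrs[OF assms(1)])
  have sub: "nbrs G v \<subseteq> verts G - {v}" by (rule nbrs_subset[OF assms(1)])
  have con: "connected_on (verts G - nbrs G v) (avoid G (nbrs G v))"
    using assms(2) less sub by (auto simp: k_connected_iff)
  have "card (insert v (nbrs G v)) < card (verts G)"
    using less assms(2) card_insert_le_m1[of "Suc (card (nbrs G v))" "nbrs G v" v]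
    by (auto simp: k_connected_iff)
  then have "\<not> verts G \<subseteq> insert v (nbrs G v)"
    using card_mono[of "insert v (nbrs G v)" "verts G"] finite_nbrs[OF assms(1)] by auto
  then obtain z where "z \<in> verts G - nbrs G v" "v \<noteq> z" by auto
  then obtain u where "{v, u} \<in> avoid G (nbrs G v)"
    using connected_on_nbr[OF con, of v z] assms(3) sub by blast
  then show False by (auto simp: avoid_def nbrs_def)
qed

lemma verts_avoid:
  assumes "graph G" "k_connected G k" "finite X" "card X < k"
  shows "verts (avoid G X) = verts G - X"
proof
  show "verts G - X \<subseteq> verts (avoid G X)"
  proof
    fix v assume v: "v \<in> verts G - X"
    then have "card X < card (nbrs G v)"
      using k_connected_deg[OF assms(1,2), of v] assms(4)
      by (simp add: deg_eq_card_nbrs[OF assms(1)])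
    then have "\<not> nbrs G v \<subseteq> X"
      using card_mono[OF assms(3), of "nbrs G v"] by auto
    then have "nbrs (avoid G X) v \<noteq> {}"
      using v by (simp add: nbrs_avoid)
    then show "v \<in> verts (avoid G X)"
      using verts_eq_nbrs[OF graph_avoid[OF assms(1)]] by auto
  qed
qed (rule verts_avoid_subset)

lemma k_connected_avoid:
  assumes "graph G" "k_connected G (k + card T)" "T \<subseteq> verts G" "k \<ge> 1"
  shows "k_connected (avoid G T) k"
proof -
  have fT: "finite T" using assms finite_verts finite_subset by blast
  have V: "verts (avoid G T) = verts G - T"
    by (rule verts_avoid[OF assms(1,2) fT]) (use assms in simp)
  show ?thesis unfolding k_connected_iff V
  proof (intro conjI allI impI)
    show "k + 1 \<le> card (verts G - T)"
      using assms(2) card_Diff_subset[OF fT assms(3)] unfolding k_connected_iff by linarith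
  next
    fix X assume X: "X \<subseteq> verts G - T" "card X < k"
    have "card (T \<union> X) < k + card T"
      using card_Un_le[of T X] X by simp
    moreover have "T \<union> X \<subseteq> verts G" using assms(3) X by auto
    ultimately have "connected_on (verts G - (T \<union> X)) (avoid G (T \<union> X))"
      using assms(2) by (simp add: k_connected_iff)
    moreover have "verts G - (T \<union> X) = verts G - T - X" by auto
    ultimately show "connected_on (verts G - T - X) (avoid (avoid G T) X)"
      by (simp add: avoid_avoid)
  qed
qed

text \<open>Deleting everything except \<open>u\<close> and \<open>v\<close> removes fewer than
  \<open>k\<close> vertices, and the remaining two vertices can only be connected by the edge
  itself.\<close>

lemma k_connected_small_complete:
  assumes "graph G" "k_connected G k" "card (verts G) \<le> Suc k"
  shows "G = complete (verts G)"
proof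
  show "complete (verts G) \<subseteq> G"
  proof
    fix e assume "e \<in> complete (verts G)"
    then obtain u v where e: "e = {u, v}" "u \<in> verts G" "v \<in> verts G" "u \<noteq> v"
      by (auto simp: complete_def)
    let ?X = "verts G - {u, v}"
    have card2: "card {u, v} = 2" using e by simp
    have "card {u, v} \<le> card (verts G)"
      using e finite_verts[OF assms(1)] by (intro card_mono) auto
    then have "card ?X < k"
      using assms(3) e card2 finite_verts[OF assms(1)] card_Diff_subset[of "{u, v}" "verts G"] by simp
    then have "connected_on (verts G - ?X) (avoid G ?X)"
      using assms(2) by (auto simp: k_connected_iff)
    then obtain w where w: "{u, w} \<in> avoid G ?X"
      by (rule connected_on_nbr[of _ _ u v]) (use e in auto)
    then have "{u, w} \<in> G" "w \<notin> ?X" by (auto simp: avoid_def)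
    moreover have "w \<in> verts G" "w \<noteq> u"
      using calculation assms(1) edge_in_verts graph_edge_neq by fast+
    ultimately show "e \<in> G" using e by auto
  qed
qed (use subset_complete[OF assms(1)] in blast)

section \<open>Removal of simplicial vertices\<close>

definition simplicial :: "'v set set \<Rightarrow> 'v \<Rightarrow> bool" where
  "simplicial G x \<longleftrightarrow> (\<forall>u v. {x, u} \<in> G \<and> {x, v} \<in> G \<and> u \<noteq> v \<longrightarrow> {u, v} \<in> G)"

text \<open>A walk through \<open>x\<close> can be shortcut, because its predecessor and successor
  are equal or adjacent.\<close>

lemma connected_on_remove_simplicial:
  assumes "graph G" "simplicial G x" "connected_on V G" "V - {x} \<noteq> {}"
  shows "connected_on (V - {x}) (avoid G {x})"
proof -
  let ?R = "{(a, b). {a, b} \<in> G}" and ?R' = "{(a, b). {a, b} \<in> avoid G {x}}"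
  \<comment> \<open>While the walk stands at \<open>x\<close>, the invariant remembers a neighbour
    of \<open>x\<close> that is reachable without using \<open>x\<close>; the shortcut leaves from
    there.\<close>
  have step: "(y \<noteq> x \<longrightarrow> (a, y) \<in> ?R'\<^sup>*) \<and>
      (y = x \<longrightarrow> (\<exists>z. {x, z} \<in> G \<and> z \<noteq> x \<and> (a, z) \<in> ?R'\<^sup>*))"
    if "(a, y) \<in> ?R\<^sup>*" "a \<noteq> x" for a y
    using that(1)
  proof (induction rule: rtrancl_induct)
    case (step y z)
    have yz: "{y, z} \<in> G" "y \<noteq> z" using step.hyps(2) graph_edge_neq[OF assms(1)] by auto
    consider "z = x" | "z \<noteq> x" "y \<noteq> x" | "z \<noteq> x" "y = x" by blast
    then show ?case
    proof cases
      case 1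
      then show ?thesis using step.IH yz by (auto simp: insert_commute)
    next
      case 2
      then have "(y, z) \<in> ?R'" using yz by (auto simp: avoid_def)
      then show ?thesis using step.IH 2 by (auto intro: rtrancl_into_rtrancl)
    next
      case 3
      then obtain w where w: "{x, w} \<in> G" "w \<noteq> x" "(a, w) \<in> ?R'\<^sup>*"
        using step.IH by auto
      have "w = z \<or> (w, z) \<in> ?R'"
        using assms(2) w 3 yz unfolding simplicial_def by (auto simp: avoid_def)
      then show ?thesis using w 3 by (auto intro: rtrancl_into_rtrancl)
    qed
  qed (use that in auto)
  show ?thesis
    using assms(3,4) step unfolding connected_on_def by blast
qed

text \<open>A simplicial vertex stays simplicial after deleting any \<open>X\<close>. So no
  connectivity is lost, and an induction on vertices can keep the same constant.\<close>

lemma k_connected_remove_simplicial: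
  assumes "graph G" "k_connected G k" "k \<ge> 2" "simplicial G x" "x \<in> verts G"
    "card (verts G) \<ge> k + 2"
  shows "k_connected (avoid G {x}) k"
proof -
  have V: "verts (avoid G {x}) = verts G - {x}"
    by (rule verts_avoid[OF assms(1,2)]) (use assms in auto)
  show ?thesis unfolding k_connected_iff V
  proof (intro conjI allI impI)
    show "k + 1 \<le> card (verts G - {x})"
      using assms finite_verts[OF assms(1)] by simp
  next
    fix X assume X: "X \<subseteq> verts G - {x}" "card X < k"
    have fX: "finite X" using X finite_verts[OF assms(1)] finite_subset by blast
    have "connected_on (verts G - X) (avoid G X)"
      using assms X by (auto simp: k_connected_iff)
    moreover have "simplicial (avoid G X) x"
      using assms(4) unfolding simplicial_def avoid_def by blast
    moreover have "verts G - X - {x} \<noteq> {}"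
    proof
      assume "verts G - X - {x} = {}"
      then have "card (verts G) \<le> card (insert x X)"
        using fX by (intro card_mono) auto
      also have "\<dots> \<le> Suc (card X)" by (simp add: card_insert_if fX)
      finally show False using assms(6) X by simp
    qed
    ultimately have "connected_on (verts G - X - {x}) (avoid (avoid G X) {x})"
      by (intro connected_on_remove_simplicial graph_avoid[OF assms(1)])
    moreover have "verts G - X - {x} = verts G - {x} - X" by auto
    ultimately show "connected_on (verts G - {x} - X) (avoid (avoid G {x}) X)"
      by (simp add: avoid_avoid insert_commute)
  qed
qed

lemma connected_common_vertex:
  assumes "connected_on (verts G) G" "G = A \<union> B" "A \<noteq> {}" "B \<noteq> {}" "{} \<notin> G"
  obtains v where "v \<in> verts A" "v \<in> verts B"
proof (rule ccontr)
  assume "\<not> thesis"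
  then have disj: "verts A \<inter> verts B = {}" using that by auto
  obtain a b where ab: "a \<in> verts A" "b \<in> verts B"
  proof -
    obtain e f where "e \<in> A" "f \<in> B" using assms(3,4) by auto
    moreover from this have "e \<noteq> {}" "f \<noteq> {}" using assms(2,5) by auto
    ultimately show ?thesis using that by (auto simp: verts_def)
  qed
  then have "(a, b) \<in> {(a, b). {a, b} \<in> G}\<^sup>*"
    using assms(1,2) unfolding connected_on_def verts_def by auto
  then have "b \<in> verts A"
  proof (induction rule: rtrancl_induct)
    case (step y z)
    have "{y, z} \<notin> B" using step.IH disj edge_in_verts[of y z B] by auto
    then have "{y, z} \<in> A" using step.hyps(2) assms(2) by auto
    then show ?case using edge_in_verts by fast
  qed (use ab in auto)
  then show False using ab disj by auto
qed

section \<open>Large stable sets and small dominating sets\<close>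

text \<open>Greedy choice in the digraph with arcs from \<open>v\<close> to \<open>f v\<close> and
  \<open>g v\<close>. The average in-degree is at most two, so some \<open>v\<close> has at most two
  in-neighbours. Choosing it discards at most five vertices: \<open>v\<close>, its two images and
  these in-neighbours.\<close>

lemma stable_set_of_two_maps:
  fixes f g :: "'a \<Rightarrow> 'a"
  assumes "finite U" "\<And>v. v \<in> U \<Longrightarrow> f v \<noteq> v \<and> g v \<noteq> v"
  obtains Y where "Y \<subseteq> U" "card U \<le> 5 * card Y" "\<And>v. v \<in> Y \<Longrightarrow> f v \<notin> Y \<and> g v \<notin> Y"
proof -
  have "\<exists>Y\<subseteq>U. card U \<le> 5 * card Y \<and> (\<forall>v\<in>Y. f v \<notin> Y \<and> g v \<notin> Y)"
    using assms
  proof (induction U rule: finite_psubset_induct)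
    case (psubset U)
    show ?case
    proof (cases "U = {}")
      case False
      let ?P = "\<lambda>v. {u \<in> U. f u = v}" and ?Q = "\<lambda>v. {u \<in> U. g u = v}"
      have fib: "(\<Sum>v\<in>U. card {u \<in> U. h u = v}) \<le> card U" for h :: "'a \<Rightarrow> 'a"
      proof -
        have "(\<Sum>v\<in>U. card {u \<in> U. h u = v}) = card (\<Union>v\<in>U. {u \<in> U. h u = v})"
          using psubset.hyps by (subst card_UN_disjoint) auto
        also have "\<dots> \<le> card U" using psubset.hyps by (intro card_mono) auto
        finally show ?thesis .
      qed
      have "\<exists>v\<in>U. card (?P v) + card (?Q v) \<le> 2"
      proof (rule ccontr)
        assume "\<not> ?thesis"
        then have "(\<Sum>v\<in>U. 3) \<le> (\<Sum>v\<in>U. card (?P v) + card (?Q v))"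
          by (intro sum_mono) (auto simp: not_le)
        also have "\<dots> \<le> card U + card U"
          unfolding sum.distrib using fib[of f] fib[of g] by simp
        finally have "card U = 0" by simp
        then show False using False psubset.hyps by simp
      qed
      then obtain v where v: "v \<in> U" "card (?P v) + card (?Q v) \<le> 2" by blast
      let ?R = "{v, f v, g v} \<union> (?P v \<union> ?Q v)"
      have finR: "finite ?R" using psubset.hyps by simp
      have "card ?R \<le> card {v, f v, g v} + (card (?P v) + card (?Q v))"
        using card_Un_le[of "{v, f v, g v}" "?P v \<union> ?Q v"] card_Un_le[of "?P v" "?Q v"] by linarith
      also have "card {v, f v, g v} \<le> 3"
        by (simp add: card_insert_if)
      finally have cR: "card ?R \<le> 5" using v(2) by linarith
      obtain Y where Y: "Y \<subseteq> U - ?R" "card (U - ?R) \<le> 5 * card Y" "\<forall>v\<in>Y. f v \<notin> Y \<and> g v \<notin> Y"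
        using psubset.IH[of "U - ?R"] psubset.prems v by auto
      have "finite Y" using Y psubset.hyps by (meson finite_Diff finite_subset)
      moreover have "v \<notin> Y" using Y by auto
      ultimately have "card (insert v Y) = Suc (card Y)" by simp
      moreover have "card U \<le> card (U - ?R) + card ?R"
        using diff_card_le_card_Diff[OF finR, of U] by linarith
      ultimately have "card U \<le> 5 * card (insert v Y)"
        using cR Y(2) by simp
      moreover have "\<forall>y\<in>insert v Y. f y \<notin> insert v Y \<and> g y \<notin> insert v Y"
        using Y psubset.prems v(1) by auto
      moreover have "insert v Y \<subseteq> U" using Y v by auto
      ultimately show ?thesis by blast
    qed auto
  qed
  then show ?thesis using that by blast
qed

text \<open>An extremal choice of \<open>A\<close> leaves only few elements with fewer than
  \<open>k\<close> neighbours in \<open>A\<close>. These are repaired by adding \<open>k\<close>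
  neighbours for each; the first set and the repair each use at most a \<open>1/(2q)\<close>
  fraction of \<open>V\<close>.\<close>

lemma small_dominating_set:
  fixes N :: "'a \<Rightarrow> 'a set" and k q :: nat
  assumes "finite V" "\<And>v. v \<in> V \<Longrightarrow> N v \<subseteq> V" "k \<ge> 1" "q \<ge> 1"
    "\<And>v. v \<in> V \<Longrightarrow> k + (2 * q * k)\<^sup>2 \<le> card (N v)"
  obtains A where "A \<subseteq> V" "q * card A \<le> card V" "\<And>v. v \<in> V \<Longrightarrow> k \<le> card (N v \<inter> A)"
proof -
  define T where "T = 2 * q * k"
  \<comment> \<open>Coverage, capped at \<open>k\<close> per element, minus a price \<open>T\<close>
    per chosen element. Comparing a maximiser with the empty set bounds its size; comparing it with
    one-element extensions bounds the number of deficient elements.\<close>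
  define \<Phi> where "\<Phi> A = int (\<Sum>u\<in>V. min k (card (N u \<inter> A))) - int (T * card A)" for A
  have finN: "finite (N v)" if "v \<in> V" for v
    using assms(1,2) that finite_subset by blast
  have "finite (\<Phi> ` Pow V)" "\<Phi> ` Pow V \<noteq> {}" using assms(1) by auto
  then obtain A where A: "A \<subseteq> V" and Amax: "\<And>B. B \<subseteq> V \<Longrightarrow> \<Phi> B \<le> \<Phi> A"
    using Max_in[of "\<Phi> ` Pow V"] Max_ge[of "\<Phi> ` Pow V"] by (smt (verit) PowD PowI imageE imageI)
  have finA: "finite A" using A assms(1) finite_subset by blast
  have cardA: "2 * q * card A \<le> card V"
  proof -
    have "0 \<le> \<Phi> A" using Amax[of "{}"] by (simp add: \<Phi>_def)
    then have "T * card A \<le> (\<Sum>u\<in>V. min k (card (N u \<inter> A)))"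
      unfolding \<Phi>_def by linarith
    also have "\<dots> \<le> (\<Sum>u\<in>V. k)" by (intro sum_mono) simp
    finally have "k * (2 * q * card A) \<le> k * card V" by (simp add: T_def mult_ac)
    then show ?thesis using assms(3) by simp
  qed
  define U where "U = {u \<in> V. card (N u \<inter> A) < k}"
  have finU: "finite U" using assms(1) by (simp add: U_def)
  \<comment> \<open>Adding \<open>v\<close> improves the coverage by one exactly at those deficient
    \<open>u\<close> with \<open>v\<close> in \<open>N u\<close>, and by maximality this does not
    outweigh the price.\<close>
  have few: "card {u \<in> U. v \<in> N u} \<le> T" if v: "v \<in> V - A" for v
  proof -
    have eq: "min k (card (N u \<inter> insert v A)) =
        min k (card (N u \<inter> A)) + (if u \<in> U \<and> v \<in> N u then 1 else 0)" if "u \<in> V" for u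
    proof (cases "v \<in> N u")
      case True
      then have "card (N u \<inter> insert v A) = Suc (card (N u \<inter> A))"
        using v finA by simp
      then show ?thesis using that True by (auto simp: U_def)
    qed simp
    have cardT: "T * card (insert v A) = T * card A + T"
      using v finA by simp
    have "(\<Sum>u\<in>V. min k (card (N u \<inter> insert v A))) =
        (\<Sum>u\<in>V. min k (card (N u \<inter> A))) + (\<Sum>u\<in>V. if u \<in> U \<and> v \<in> N u then 1 else 0)"
      by (simp add: eq sum.distrib)
    also have "(\<Sum>u\<in>V. if u \<in> U \<and> v \<in> N u then 1 else 0) = card {u \<in> U. v \<in> N u}"
    proof -
      have "{u \<in> V. u \<in> U \<and> v \<in> N u} = {u \<in> U. v \<in> N u}" by (auto simp: U_def)
      then show ?thesis using assms(1) by (simp add: sum.If_cases Int_def)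
    qed
    finally have "int (card {u \<in> U. v \<in> N u}) - int T = \<Phi> (insert v A) - \<Phi> A"
      using cardT unfolding \<Phi>_def by linarith
    also have "\<dots> \<le> 0" using Amax[of "insert v A"] A v by simp
    finally show ?thesis by simp
  qed
  \<comment> \<open>Double counting of pairs \<open>u\<close>, \<open>v\<close> with
    \<open>v\<close> in \<open>N u - A\<close>: every deficient \<open>u\<close> has at least
    \<open>T\<^sup>2\<close> such \<open>v\<close>, while every \<open>v\<close> occurs for at most
    \<open>T\<close> deficient \<open>u\<close>. The square in the degree hypothesis is there to
    leave one factor \<open>T\<close>.\<close>
  have cardU: "2 * q * k * card U \<le> card V"
  proof -
    have "T\<^sup>2 * card U = (\<Sum>u\<in>U. T\<^sup>2)" by simp
    also have "\<dots> \<le> (\<Sum>u\<in>U. card (N u - A))"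
    proof (intro sum_mono)
      fix u assume u: "u \<in> U"
      then have "card (N u \<inter> A) < k" "k + T\<^sup>2 \<le> card (N u)" "finite (N u)"
        using assms(5)[of u] finN by (auto simp: U_def T_def)
      then show "T\<^sup>2 \<le> card (N u - A)"
        using card_Diff_subset_Int[of "N u" A] by simp
    qed
    also have "\<dots> = (\<Sum>u\<in>U. \<Sum>v\<in>V - A. if v \<in> N u then 1 else 0)"
    proof (intro sum.cong refl)
      fix u assume "u \<in> U"
      then have "N u - A = {v \<in> V - A. v \<in> N u}" using assms(2) by (auto simp: U_def)
      then show "card (N u - A) = (\<Sum>v\<in>V - A. if v \<in> N u then 1 else 0)"
        using assms(1) by (simp add: sum.If_cases Int_def)
    qed
    also have "\<dots> = (\<Sum>v\<in>V - A. \<Sum>u\<in>U. if v \<in> N u then 1 else 0)"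
      by (rule sum.swap)
    also have "\<dots> = (\<Sum>v\<in>V - A. card {u \<in> U. v \<in> N u})"
      using finU by (intro sum.cong refl) (simp add: sum.If_cases Int_def)
    also have "\<dots> \<le> (\<Sum>v\<in>V - A. T)" by (intro sum_mono few)
    also have "\<dots> \<le> T * card V" using assms(1) by (simp add: card_mono)
    finally have "T * (T * card U) \<le> T * card V" by (simp add: power2_eq_square mult_ac)
    then show ?thesis using assms(3,4) by (simp add: T_def mult_ac)
  qed
  have "\<forall>u\<in>U. \<exists>S\<subseteq>N u. card S = k"
  proof
    fix u assume "u \<in> U"
    then have "k \<le> card (N u)" using assms(5)[of u] by (auto simp: U_def)
    then show "\<exists>S\<subseteq>N u. card S = k" by (metis obtain_subset_with_card_n)
  qed
  then obtain S where S: "\<And>u. u \<in> U \<Longrightarrow> S u \<subseteq> N u \<and> card (S u) = k" by metis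
  let ?A = "A \<union> (\<Union>u\<in>U. S u)"
  have sub: "?A \<subseteq> V" using A S assms(2) by (fastforce simp: U_def)
  show ?thesis
  proof (rule that[OF sub])
    have "card (\<Union>u\<in>U. S u) \<le> (\<Sum>u\<in>U. card (S u))" by (rule card_UN_le[OF finU])
    also have "\<dots> = k * card U" using S by simp
    finally have "card ?A \<le> card A + k * card U"
      using card_Un_le[of A "\<Union>u\<in>U. S u"] by linarith
    then have "2 * q * card ?A \<le> 2 * q * (card A + k * card U)" by (intro mult_le_mono2)
    also have "\<dots> = 2 * q * card A + 2 * q * k * card U" by (simp add: algebra_simps)
    also have "\<dots> \<le> 2 * card V" using cardA cardU by linarith
    finally show "q * card ?A \<le> card V" by simp
  next
    fix v assume v: "v \<in> V"
    have fin: "finite (N v)" by (rule finN[OF v])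
    show "k \<le> card (N v \<inter> ?A)"
    proof (cases "v \<in> U")
      case True
      then have "card (S v) \<le> card (N v \<inter> ?A)" using S fin by (intro card_mono) auto
      then show ?thesis using S True by simp
    next
      case False
      have "card (N v \<inter> A) \<le> card (N v \<inter> ?A)" using fin by (intro card_mono) auto
      then show ?thesis using False v by (simp add: U_def)
    qed
  qed
qed

section \<open>One-extendable graph matroid families\<close>

locale one_extendable_family =
  fixes M :: "'v set set \<Rightarrow> 'v set set \<Rightarrow> bool"
  assumes family: "graph_matroid_family M"
    and extendable: "one_extendable M"
begin

section \<open>One independence predicate for the whole family\<close>

abbreviation d :: nat where
  "d \<equiv> dimensionality M"

text \<open>By the restriction axiom, independence of an edge set does not depend on the ambient
  graph, so each set can be tested in its own matroid.\<close>

definition ind :: "'v set set \<Rightarrow> bool" where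
  "ind F \<longleftrightarrow> graph F \<and> M F F"

lemma M_iff_ind: "graph G \<Longrightarrow> F \<subseteq> G \<Longrightarrow> M G F \<longleftrightarrow> ind F"
proof -
  assume G: "graph G" and F: "F \<subseteq> G"
  have "M F F \<longleftrightarrow> F \<subseteq> F \<and> M G F"
    using family G F unfolding graph_matroid_family_def by (elim conjE) simp
  then show ?thesis using graph_subset[OF G F] by (simp add: ind_def)
qed

lemma matroid_M: "graph G \<Longrightarrow> matroid G (M G)"
  using family unfolding graph_matroid_family_def by (elim conjE) simp

sublocale finitary_matroid ind
proof
  show "finite F" if "ind F" for F
    using that by (simp add: ind_def graph_finite)
  have "graph {}" by (simp add: graph_def)
  then show "ind {}"
    using matroid_M by (auto simp: ind_def matroid_def)
  show "ind A" if B: "ind B" "A \<subseteq> B" for A B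
  proof -
    have G: "graph B" "M B B" using B by (auto simp: ind_def)
    then have "M B A" using matroid_M[OF G(1)] B(2) unfolding matroid_def by (elim conjE) blast
    then show ?thesis using M_iff_ind[OF G(1) B(2)] by simp
  qed
  show "\<exists>x\<in>B - A. ind (insert x A)" if AB: "ind A" "ind B" "card A < card B" for A B
  proof -
    have G: "graph (A \<union> B)" using AB graph_Un by (auto simp: ind_def)
    have "M (A \<union> B) A" "M (A \<union> B) B" using AB M_iff_ind[OF G] by auto
    then obtain x where "x \<in> B - A" "M (A \<union> B) (insert x A)"
      using matroid_M[OF G] AB(3) unfolding matroid_def by (elim conjE) blast
    then show ?thesis using M_iff_ind[OF G, of "insert x A"] by auto
  qed
qed

lemma rank_eq_rk: "graph G \<Longrightarrow> rank M G = rk G"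
proof -
  assume "graph G"
  then have "{F. F \<subseteq> G \<and> M G F} = {F. F \<subseteq> G \<and> ind F}" using M_iff_ind by auto
  then show ?thesis by (simp add: rank_def rk_def)
qed

lemma indep_iff_ind: "graph G \<Longrightarrow> indep M G \<longleftrightarrow> ind G"
  by (simp add: indep_def rank_eq_rk I_iff_rk graph_finite)

lemma circuit_iff: "circuit M C \<longleftrightarrow> graph C \<and> \<not> ind C \<and> (\<forall>e\<in>C. ind (C - {e}))"
proof -
  have "graph C \<Longrightarrow> indep M (C - {e}) \<longleftrightarrow> ind (C - {e})" for e
    using indep_iff_ind graph_subset[of C "C - {e}"] by auto
  then show ?thesis using indep_iff_ind by (auto simp: circuit_def)
qed

section \<open>Circuits and the dimensionality\<close>

lemma d_pos: "1 \<le> d"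
  using extendable by (simp add: one_extendable_def)

lemma circuit_verts_nonempty:
  assumes "circuit M C"
  shows "verts C \<noteq> {}"
proof
  assume "verts C = {}"
  then have "C = {}"
    using assms unfolding circuit_iff graph_def verts_def by (metis Union_empty_conv card.empty ex_in_conv zero_neq_numeral)
  then show False using assms I_empty by (simp add: circuit_iff)
qed

lemma circuit_deg:
  assumes "circuit M C" "v \<in> verts C"
  shows "Suc d \<le> deg C v"
proof -
  have "d \<le> mindeg C - 1"
    unfolding dimensionality_def using assms by (intro Least_le) auto
  \<comment> \<open>The subtraction in \<open>dimensionality\<close> is truncated; since
    \<open>d\<close> is positive, the bound can still be transferred to
    \<open>mindeg C\<close>.\<close>
  then have "Suc d \<le> mindeg C" using d_pos by simp
  also have "\<dots> \<le> deg C v"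
    unfolding mindeg_def using assms finite_verts[of C] by (intro Min_le) (auto simp: circuit_iff)
  finally show ?thesis .
qed

lemma minimum_degree_circuit: "\<exists>C x. circuit M C \<and> x \<in> verts C \<and> deg C x = Suc d"
proof -
  obtain G where "graph G" "\<not> ind G"
    using extendable by (auto simp: one_extendable_def nontrivial_def indep_iff_ind)
  then obtain C1 where "C1 \<subseteq> G" "\<not> ind C1" "\<And>e. e \<in> C1 \<Longrightarrow> ind (C1 - {e})"
    using circuit_exists graph_finite by metis
  then have "circuit M C1"
    using \<open>graph G\<close> graph_subset by (auto simp: circuit_iff)
  then have "\<exists>k. \<exists>C. circuit M C \<and> k = mindeg C - 1" by auto
  then have "\<exists>C. circuit M C \<and> d = mindeg C - 1"
    unfolding dimensionality_def by (rule LeastI_ex)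
  then obtain C where C: "circuit M C" "d = mindeg C - 1" by auto
  have "mindeg C \<in> deg C ` verts C"
    unfolding mindeg_def using finite_verts[of C] circuit_verts_nonempty[OF C(1)] C(1)
    by (intro Min_in) (auto simp: circuit_iff)
  then show ?thesis using C d_pos by fastforce
qed

section \<open>Isomorphic copies and added vertices\<close>

lemma ind_image_iff:
  assumes "graph F" "inj_on \<pi> (verts F)"
  shows "ind ((`) \<pi> ` F) \<longleftrightarrow> ind F"
proof -
  have sub: "e \<subseteq> verts F" if "e \<in> F" for e
    using that by (auto simp: verts_def)
  have "card (\<pi> ` e) = 2" if "e \<in> F" for e
    using that assms sub[OF that] card_image[OF inj_on_subset[OF assms(2)]] by (auto simp: graph_def)
  then have G: "graph ((`) \<pi> ` F)"
    using assms(1) by (auto simp: graph_def)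
  have V: "verts ((`) \<pi> ` F) = \<pi> ` verts F"
    by (auto simp: verts_def)
  have edge: "{u, v} \<in> F \<longleftrightarrow> {\<pi> u, \<pi> v} \<in> (`) \<pi> ` F" if uv: "u \<in> verts F" "v \<in> verts F" for u v
  proof
    assume "{\<pi> u, \<pi> v} \<in> (`) \<pi> ` F"
    then obtain e where e: "e \<in> F" "\<pi> ` {u, v} = \<pi> ` e" by auto
    then have "{u, v} = e"
      using inj_on_image_eq_iff[OF assms(2), of "{u, v}" e] sub uv by auto
    then show "{u, v} \<in> F" using e by simp
  qed (auto simp: image_iff intro!: bexI[of _ "{u, v}"])
  have "graph_iso \<pi> F ((`) \<pi> ` F)"
    unfolding graph_iso_def V using assms(2) edge by (simp add: inj_on_imp_bij_betw)
  then have "M F F \<longleftrightarrow> M ((`) \<pi> ` F) ((`) \<pi> ` F)"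
    using family assms(1) G unfolding graph_matroid_family_def by (elim conjE) simp
  then show ?thesis using assms(1) G by (simp add: ind_def)
qed

text \<open>A circuit in the union would have to use an edge of \<open>T\<close>, hence
  \<open>v\<close>, but all its edges at \<open>v\<close> lie in \<open>T\<close> and these are too
  few for a circuit.\<close>

lemma ind_add_vertex:
  assumes "ind F" "v \<notin> verts F" "finite T" "\<And>e. e \<in> T \<Longrightarrow> v \<in> e \<and> card e = 2" "card T \<le> d"
  shows "ind (F \<union> T)"
proof (rule ccontr)
  assume dep: "\<not> ind (F \<union> T)"
  have G: "graph (F \<union> T)" using assms by (auto simp: ind_def graph_def)
  obtain C where C: "C \<subseteq> F \<union> T" "\<not> ind C" "\<And>e. e \<in> C \<Longrightarrow> ind (C - {e})"
    using circuit_exists[OF graph_finite[OF G] dep] by metis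
  then have circ: "circuit M C" using graph_subset[OF G] by (auto simp: circuit_iff)
  have "\<not> C \<subseteq> F" using I_subset[OF assms(1)] C by auto
  then have "v \<in> verts C" using C assms(4) by (fastforce simp: verts_def)
  then have "Suc d \<le> card {e \<in> C. v \<in> e}"
    using circuit_deg[OF circ] by (simp add: deg_def)
  also have "\<dots> \<le> card T"
    using C assms(2,3) by (intro card_mono) (auto simp: verts_def)
  finally show False using assms(5) by simp
qed

text \<open>Each edge is added through its far end, which is new to the edges already present. Only
  one edge is added at a new vertex each time, so \<open>d_pos\<close> suffices for stars of any
  size.\<close>

lemma ind_star:
  assumes "finite T" "\<And>e. e \<in> T \<Longrightarrow> v \<in> e \<and> card e = 2"
  shows "ind T"
  using assms
proof (induction T)
  case empty
  then show ?case by (simp add: I_empty)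
next
  case (insert e T)
  then obtain s where s: "e = {v, s}" "s \<noteq> v"
    by (metis graph_edgeE[of "{e}" e v] card.empty finite.intros graph_def insert_iff empty_iff)
  have "s \<notin> verts T"
  proof
    assume "s \<in> verts T"
    then obtain e' where e': "e' \<in> T" "s \<in> e'" by (auto simp: verts_def)
    then have "card e' = 2" "v \<in> e'" using insert by auto
    then have "e' = {v, s}" using e' s by (auto simp: card_2_iff)
    then show False using e' s insert by auto
  qed
  then have "ind (T \<union> {e})"
    using insert s d_pos by (intro ind_add_vertex[of T s]) auto
  then show ?case by simp
qed

lemma deg_le_rk:
  assumes "graph G"
  shows "deg G v \<le> rk G"
proof -
  have "ind {e \<in> G. v \<in> e}"
    using assms by (intro ind_star[of _ v]) (auto simp: graph_def)
  then show ?thesis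
    unfolding deg_def using card_le_rk[OF graph_finite[OF assms]] by auto
qed

lemma rk_add_vertex:
  assumes "graph G"
  shows "rk (avoid G {v}) + min d (deg G v) \<le> rk G"
proof -
  obtain B where B: "B \<subseteq> avoid G {v}" "ind B" "card B = rk (avoid G {v})"
    using basis_exists[of "avoid G {v}"] graph_finite[OF graph_avoid[OF assms]] by auto
  obtain T where T: "T \<subseteq> {e \<in> G. v \<in> e}" "card T = min d (deg G v)" "finite T"
    using obtain_subset_with_card_n[of "min d (deg G v)" "{e \<in> G. v \<in> e}"]
    by (auto simp: deg_def)
  have v: "v \<notin> verts B" using B by (auto simp: verts_def avoid_def)
  have "ind (B \<union> T)"
    using B v T assms by (intro ind_add_vertex[of B v T]) (auto simp: graph_def)
  then have "card (B \<union> T) \<le> rk G"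
    using B T avoid_subset[of G "{v}"] by (intro card_le_rk[OF graph_finite[OF assms]]) auto
  moreover have "B \<inter> T = {}" using T v by (auto simp: verts_def)
  ultimately show ?thesis
    using B T I_finite[OF B(2)] by (simp add: card_Un_disjoint)
qed

text \<open>An edge at a missed vertex could be added to the basis. Consequently an edge split of a
  basis may attach the new vertex to any vertex of the graph.\<close>

lemma verts_basis:
  assumes "graph G" "B \<subseteq> G" "ind B" "card B = rk G"
  shows "verts B = verts G"
proof
  show "verts G \<subseteq> verts B"
  proof
    fix y assume "y \<in> verts G"
    then obtain e where e: "e \<in> G" "y \<in> e" by (auto simp: verts_def)
    show "y \<in> verts B"
    proof (rule ccontr)
      assume y: "y \<notin> verts B"
      then have "ind (B \<union> {e})"
        using assms e d_pos by (intro ind_add_vertex[of B y]) (auto simp: graph_def)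
      then have "card (insert e B) \<le> rk G"
        using assms e by (intro card_le_rk[OF graph_finite[OF assms(1)]]) auto
      moreover have "e \<notin> B" using y e by (auto simp: verts_def)
      ultimately show False using assms(4) I_finite[OF assms(3)] by simp
    qed
  qed
qed (use assms verts_mono in auto)

text \<open>If a basis of the graph with \<open>{u, w}\<close> added uses this edge, splitting it
  gives an independent subgraph of \<open>G\<close>; otherwise \<open>rk_add_vertex\<close> is
  enough. When \<open>{u, w}\<close> is not spanned by \<open>G\<close> without \<open>v\<close>,
  this yields a gain of \<open>d + 1\<close> at \<open>v\<close>.\<close>

lemma rk_split_vertex:
  assumes "graph G" "{v, u} \<in> G" "{v, w} \<in> G" "u \<noteq> w" "Suc d \<le> deg G v"
    and nb: "nbrs G v \<subseteq> verts (avoid G {v})"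
  shows "rk (insert {u, w} (avoid G {v})) + d \<le> rk G"
proof -
  let ?G' = "insert {u, w} (avoid G {v})"
  have uv: "u \<noteq> v" "w \<noteq> v" using assms graph_edge_neq by fast+
  have G': "graph ?G'" using graph_avoid[OF assms(1)] assms(4) by (auto simp: graph_def)
  obtain B where B: "B \<subseteq> ?G'" "ind B" "card B = rk ?G'"
    using basis_exists[OF graph_finite[OF G']] .
  have VB: "verts B = verts ?G'" by (rule verts_basis[OF G' B])
  have vB: "v \<notin> verts B" using VB uv by (auto simp: verts_def avoid_def)
  show ?thesis
  proof (cases "{u, w} \<in> B")
    case False
    then have "rk ?G' \<le> rk (avoid G {v})"
      using B by (metis card_le_rk graph_avoid graph_finite assms(1) subset_insert)
    then show ?thesis using rk_add_vertex[OF assms(1), of v] assms(5) by simp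
  next
    case True
    have fin: "finite (nbrs G v)" by (rule finite_nbrs[OF assms(1)])
    have uw: "{u, w} \<subseteq> nbrs G v" using assms by (auto simp: nbrs_def)
    then have "d - 1 \<le> card (nbrs G v - {u, w})"
      using assms(4,5) fin card_Diff_subset[of "{u, w}" "nbrs G v"]
      by (simp add: deg_eq_card_nbrs[OF assms(1)])
    then obtain S where S: "S \<subseteq> nbrs G v - {u, w}" "card S = d - 1" "finite S"
      by (metis obtain_subset_with_card_n)
    have SB: "S \<subseteq> verts B - {u, w}"
      using S nb verts_mono[of "avoid G {v}" ?G'] VB by auto
    have "graph B" using B by (simp add: ind_def)
    then have "indep M (edge_split B u w v S)"
      using extendable B True vB SB S unfolding one_extendable_def
      by (auto simp: indep_iff_ind)
    moreover have sub: "edge_split B u w v S \<subseteq> G"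
      using B S uw avoid_subset[of G "{v}"] by (auto simp: edge_split_def nbrs_def)
    ultimately have "ind (edge_split B u w v S)"
      using indep_iff_ind graph_subset[OF assms(1)] by blast
    then have "card (edge_split B u w v S) \<le> rk G"
      using sub by (intro card_le_rk[OF graph_finite[OF assms(1)]])
    \<comment> \<open>One edge is lost and \<open>2 + (d - 1)\<close> edges are gained;
      \<open>d_pos\<close> makes the subtraction exact.\<close>
    moreover have "card (edge_split B u w v S) = card B + d"
    proof -
      have "(B - {{u, w}}) \<inter> (\<lambda>x. {v, x}) ` ({u, w} \<union> S) = {}"
        using vB by (auto simp: verts_def)
      then have "card (edge_split B u w v S) = card (B - {{u, w}}) + card ({u, w} \<union> S)"
        unfolding edge_split_def using I_finite[OF B(2)] S
        by (simp add: card_Un_disjoint card_image[OF inj_on_star] del: Un_insert_left image_insert)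
      also have "card ({u, w} \<union> S) = 2 + card S"
        using S assms(4) by (subst card_Un_disjoint) auto
      also have "card (B - {{u, w}}) = card B - 1" using True by simp
      also have "card B \<ge> 1" using True I_finite[OF B(2)] by (metis card_0_eq empty_iff less_one not_le)
      ultimately show ?thesis using S d_pos by simp
    qed
    ultimately show ?thesis using B by simp
  qed
qed

text \<open>Degrees are counted towards vertices outside \<open>X\<close>, which are present from
  the start, so the vertices of \<open>Z\<close> can return in any order.\<close>

lemma rk_add_vertices:
  assumes "graph G" "finite Z" "Z \<subseteq> X" "\<And>z. z \<in> Z \<Longrightarrow> d \<le> card (nbrs G z - X)"
  shows "rk (avoid G X) + d * card Z \<le> rk (avoid G (X - Z))"
  using assms(2-4)
proof (induction Z)
  case (insert z Z)
  let ?H = "avoid G (X - insert z Z)"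
  have H: "graph ?H" by (rule graph_avoid[OF assms(1)])
  have eq: "avoid ?H {z} = avoid G (X - Z)"
    using insert by (auto simp: avoid_def)
  have "nbrs ?H z = nbrs G z - (X - insert z Z)" by (rule nbrs_avoid) simp
  then have "card (nbrs G z - X) \<le> deg ?H z"
    unfolding deg_eq_card_nbrs[OF H] using finite_nbrs[OF assms(1)] by (intro card_mono) auto
  then have "d \<le> deg ?H z" using insert.prems(2)[of z] by simp
  then have "rk (avoid G (X - Z)) + d \<le> rk ?H"
    using rk_add_vertex[OF H, of z] eq by simp
  then show ?case using insert by (simp add: algebra_simps)
qed simp

section \<open>The rank of complete graphs\<close>

definition base_circuit :: "'v set set" where
  "base_circuit = (SOME C. circuit M C \<and> (\<exists>x. x \<in> verts C \<and> deg C x = Suc d))"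

text \<open>From \<open>card base\<close> vertices on, complete graphs gain exactly \<open>d\<close>
  per vertex; \<open>rk (complete base)\<close> supplies the additive constant in later
  bounds.\<close>

definition base :: "'v set" where
  "base = verts base_circuit"

lemma base_circuit: "circuit M base_circuit" "\<exists>x. x \<in> base \<and> deg base_circuit x = Suc d"
proof -
  have "\<exists>C. circuit M C \<and> (\<exists>x. x \<in> verts C \<and> deg C x = Suc d)"
    using minimum_degree_circuit by blast
  then have "circuit M base_circuit \<and> (\<exists>x. x \<in> base \<and> deg base_circuit x = Suc d)"
    unfolding base_circuit_def base_def by (rule someI_ex)
  then show "circuit M base_circuit" "\<exists>x. x \<in> base \<and> deg base_circuit x = Suc d" by auto
qed

lemma finite_base: "finite base"
  using base_circuit(1) finite_verts[of base_circuit] by (simp add: base_def circuit_iff)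

lemma card_base: "d + 2 \<le> card base"
proof -
  obtain x where x: "x \<in> base" "deg base_circuit x = Suc d" using base_circuit by blast
  have G: "graph base_circuit" using base_circuit(1) by (simp add: circuit_iff)
  have "card (nbrs base_circuit x) \<le> card (base - {x})"
    using nbrs_subset[OF G] finite_base by (intro card_mono) (auto simp: base_def)
  then show ?thesis
    using x finite_base by (simp add: deg_eq_card_nbrs[OF G])
qed

text \<open>Once \<open>v\<close> is joined to \<open>d\<close> vertices of a complete graph, every
  further edge at \<open>v\<close> completes a copy of \<open>base_circuit\<close> whose vertex of
  degree \<open>d + 1\<close> is placed at \<open>v\<close>. All other edges of the copy are already
  there, and the bound on \<open>card base\<close> ensures that it fits.\<close>

lemma rk_complete_insert_span:
  assumes "finite V" "v \<notin> V" "S \<subseteq> V" "card S = d" "card base \<le> Suc (card V)" "u \<in> V"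
  shows "rk (insert {v, u} (complete V \<union> (\<lambda>s. {v, s}) ` S)) = rk (complete V \<union> (\<lambda>s. {v, s}) ` S)"
proof (cases "u \<in> S")
  case False
  let ?C = base_circuit
  have C: "graph ?C" "\<not> ind ?C" "\<And>e. e \<in> ?C \<Longrightarrow> ind (?C - {e})"
    using base_circuit(1) by (auto simp: circuit_iff)
  obtain x where x: "x \<in> base" "deg ?C x = Suc d" using base_circuit by blast
  let ?N = "nbrs ?C x"
  have finS: "finite S" using assms finite_subset by blast
  have N: "finite ?N" "card ?N = Suc d" "?N \<subseteq> base - {x}"
    using x finite_nbrs[OF C(1)] deg_eq_card_nbrs[OF C(1)] nbrs_subset[OF C(1)] by (auto simp: base_def)
  have "card ?N = card (insert u S)" using N False finS assms(4) by simp
  then obtain p where p: "bij_betw p ?N (insert u S)"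
    using N(1) finS finite_same_card_bij by blast
  have "card (base - {x} - ?N) \<le> card (V - insert u S)"
  proof -
    have "card (base - {x} - ?N) = card base - 1 - Suc d"
      using N x finite_base by (simp add: card_Diff_subset)
    moreover have "card (V - insert u S) = card V - Suc d"
      using assms finS False by (subst card_Diff_subset) auto
    ultimately show ?thesis using assms(5) by simp
  qed
  then obtain q where q: "inj_on q (base - {x} - ?N)" "q ` (base - {x} - ?N) \<subseteq> V - insert u S"
    using card_le_inj[of "base - {x} - ?N" "V - insert u S"] finite_base assms(1) by auto
  \<comment> \<open>The embedding of the circuit: \<open>x\<close> goes to \<open>v\<close>, the
    \<open>d + 1\<close> neighbours of \<open>x\<close> onto \<open>insert u S\<close>, and the
    remaining vertices injectively into the rest of \<open>V\<close>.\<close>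
  define \<pi> where "\<pi> y = (if y = x then v else if y \<in> ?N then p y else q y)" for y
  have pi_x: "\<pi> x = v" by (simp add: \<pi>_def)
  have pi_N: "\<pi> y = p y" "p y \<in> insert u S" if "y \<in> ?N" for y
    using that N(3) bij_betw_apply[OF p that] by (auto simp: \<pi>_def)
  have pi_R: "\<pi> y = q y" "q y \<in> V - insert u S" if "y \<in> base - {x} - ?N" for y
    using that q(2) by (auto simp: \<pi>_def image_subset_iff)
  have pi_V: "\<pi> y \<in> V" if "y \<in> base - {x}" for y
    using that pi_N[of y] pi_R[of y] assms(3,6) by (cases "y \<in> ?N") auto
  have inj: "inj_on \<pi> base"
  proof (rule inj_onI)
    fix y z assume yz: "y \<in> base" "z \<in> base" "\<pi> y = \<pi> z"
    show "y = z"
    proof (cases "y = x \<or> z = x")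
      case True
      then show ?thesis using yz pi_V[of y] pi_V[of z] pi_x assms(2) by (metis DiffI singletonD)
    next
      case False
      then consider "y \<in> ?N" "z \<in> ?N" | "y \<in> ?N" "z \<in> base - {x} - ?N"
        | "y \<in> base - {x} - ?N" "z \<in> ?N" | "y \<in> base - {x} - ?N" "z \<in> base - {x} - ?N"
        using yz by blast
      then show ?thesis
      proof cases
        case 1
        then show ?thesis using yz(3) pi_N(1) p by (simp add: bij_betw_def inj_on_def)
      next
        case 2
        then show ?thesis using yz(3) pi_N[of y] pi_R[of z] by simp
      next
        case 3
        then show ?thesis using yz(3) pi_R[of y] pi_N[of z] by auto
      next
        case 4
        then show ?thesis using yz(3) pi_R(1) q(1) by (metis inj_onD)
      qed
    qed
  qed
  have sub: "e \<subseteq> base" if "e \<in> ?C" for e using that by (auto simp: base_def verts_def)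
  obtain y where y: "y \<in> ?N" "p y = u"
    using p unfolding bij_betw_def by (metis imageE insertI1)
  have xy: "{x, y} \<in> ?C" using y by (simp add: nbrs_def)
  have pxy: "\<pi> ` {x, y} = {v, u}" using pi_x pi_N[OF y(1)] y by simp
  let ?D = "(`) \<pi> ` ?C"
  have injI: "inj_on ((`) \<pi>) ?C"
    using inj_on_subset[OF inj_on_image_Pow[OF inj], of ?C] sub by auto
  have D: "?D - {{v, u}} = (`) \<pi> ` (?C - {{x, y}})"
    using inj_on_image_set_diff[OF injI, of ?C "{{x, y}}"] xy pxy by simp
  show ?thesis
  proof (rule rk_circuit_span[of _ ?D])
    show "finite (complete V \<union> (\<lambda>s. {v, s}) ` S)"
      using graph_finite[OF graph_complete[OF assms(1)]] finS by simp
    show "\<not> ind ?D"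
      using ind_image_iff[OF C(1), of \<pi>] inj C(2) by (simp add: base_def)
    have "graph (?C - {{x, y}})" using C(1) graph_subset by blast
    moreover have "inj_on \<pi> (verts (?C - {{x, y}}))"
      using inj_on_subset[OF inj] verts_mono[of "?C - {{x, y}}" ?C] by (auto simp: base_def)
    ultimately show "ind (?D - {{v, u}})"
      unfolding D using ind_image_iff C(3)[OF xy] by blast
    show "?D - {{v, u}} \<subseteq> complete V \<union> (\<lambda>s. {v, s}) ` S"
      unfolding D
    proof
      fix g assume "g \<in> (`) \<pi> ` (?C - {{x, y}})"
      then obtain e where e: "e \<in> ?C" "e \<noteq> {x, y}" "g = \<pi> ` e" by auto
      show "g \<in> complete V \<union> (\<lambda>s. {v, s}) ` S"
      proof (cases "x \<in> e")
        case True
        then obtain z where z: "e = {x, z}" by (metis graph_edgeE[OF C(1) e(1)])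
        then have zN: "z \<in> ?N" "z \<noteq> y" using e by (auto simp: nbrs_def)
        then have "p z \<noteq> u" using p y by (auto simp: bij_betw_def inj_on_def)
        then have "\<pi> z \<in> S" using pi_N[OF zN(1)] by auto
        then show ?thesis using e z pi_x by auto
      next
        case False
        obtain a b where ab: "e = {a, b}" "a \<noteq> b"
          using C(1) e(1) by (auto simp: graph_def card_2_iff)
        have "a \<in> base - {x}" "b \<in> base - {x}" using ab sub[OF e(1)] False by auto
        moreover from this have "\<pi> a \<noteq> \<pi> b" using ab inj by (auto simp: inj_on_def)
        ultimately show ?thesis using e ab pi_V by (simp add: complete_edge_iff)
      qed
    qed
  qed
qed (simp add: insert_absorb)

lemma rk_complete_insert_eq:
  assumes "finite V" "v \<notin> V" "S \<subseteq> V" "card S = d" "card base \<le> Suc (card V)"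
  shows "rk (complete (insert v V)) = rk (complete V \<union> (\<lambda>s. {v, s}) ` S)"
proof -
  have fin: "finite (complete V)" "finite S"
    using assms graph_finite[OF graph_complete] finite_subset by auto
  have "rk ((complete V \<union> (\<lambda>s. {v, s}) ` S) \<union> (\<lambda>s. {v, s}) ` V) = rk (complete V \<union> (\<lambda>s. {v, s}) ` S)"
    using assms fin rk_complete_insert_span[OF assms] by (intro rk_span) auto
  moreover have "(complete V \<union> (\<lambda>s. {v, s}) ` S) \<union> (\<lambda>s. {v, s}) ` V = complete (insert v V)"
    using assms by (auto simp: complete_insert)
  ultimately show ?thesis by simp
qed

lemma rk_complete_insert:
  assumes "finite V" "v \<notin> V" "card base \<le> Suc (card V)"
  shows "rk (complete (insert v V)) = rk (complete V) + d"
proof (rule antisym)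
  have dV: "d \<le> card V" using assms(3) card_base by simp
  then obtain S where S: "S \<subseteq> V" "card S = d" "finite S"
    by (metis obtain_subset_with_card_n)
  have "rk (complete V \<union> (\<lambda>s. {v, s}) ` S) \<le> rk (complete V) + card ((\<lambda>s. {v, s}) ` S)"
    using S graph_finite[OF graph_complete[OF assms(1)]] by (intro rk_Un_le) auto
  also have "card ((\<lambda>s. {v, s}) ` S) = d" using S by (simp add: card_image[OF inj_on_star])
  finally show "rk (complete (insert v V)) \<le> rk (complete V) + d"
    using rk_complete_insert_eq[OF assms(1,2) S(1,2) assms(3)] by simp
  have G: "graph (complete (insert v V))" using graph_complete[of "insert v V"] assms by simp
  have "nbrs (complete (insert v V)) v = V" using assms(2) by (auto simp: nbrs_def complete_edge_iff)
  then have "deg (complete (insert v V)) v = card V" by (simp add: deg_eq_card_nbrs[OF G])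
  moreover have "avoid (complete (insert v V)) {v} = complete V"
    using assms(2) by (simp add: avoid_complete)
  ultimately show "rk (complete V) + d \<le> rk (complete (insert v V))"
    using rk_add_vertex[OF G, of v] dV by simp
qed

lemma rk_complete_Un:
  assumes "finite W" "finite V" "card base \<le> Suc (card V)" "V \<inter> W = {}"
  shows "rk (complete (V \<union> W)) = rk (complete V) + d * card W"
  using assms(1,4)
proof (induction W)
  case (insert w W)
  have "card V \<le> card (V \<union> W)" using assms insert by (intro card_mono) auto
  then have "rk (complete (insert w (V \<union> W))) = rk (complete (V \<union> W)) + d"
    using insert assms by (intro rk_complete_insert) auto
  then show ?case using insert by simp
qed simp

text \<open>\<open>V\<close> need not contain \<open>base\<close>, so both are enlarged to their
  union, where every added vertex contributes \<open>d\<close>.\<close>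

lemma rk_complete:
  assumes "finite V" "card base \<le> card V"
  shows "rk (complete V) + d * card base = rk (complete base) + d * card V"
proof -
  have "rk (complete (V \<union> (base - V))) = rk (complete V) + d * card (base - V)"
    using assms finite_base by (intro rk_complete_Un) auto
  moreover have "rk (complete (base \<union> (V - base))) = rk (complete base) + d * card (V - base)"
    using assms finite_base by (intro rk_complete_Un) auto
  moreover have "V \<union> (base - V) = base \<union> (V - base)" by auto
  ultimately have "rk (complete V) + d * card (base - V) = rk (complete base) + d * card (V - base)"
    by simp
  moreover have "card base = card (base - V) + card (V \<inter> base)"
    using card_Diff_subset_Int[of base V] finite_base card_mono[of base "base \<inter> V"]
    by (simp add: Int_commute)
  moreover have "card V = card (V - base) + card (V \<inter> base)"
    using card_Diff_subset_Int[of V base] assms card_mono[of V "V \<inter> base"] by simp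
  ultimately show ?thesis by (simp add: algebra_simps)
qed

lemma rk_complete_le:
  assumes "finite V" "card base \<le> card V"
  shows "rk (complete V) \<le> rk (complete base) + d * card V"
  using rk_complete[OF assms] by simp

subsection \<open>Highly connected graphs are rigid\<close>

text \<open>For a graph \<open>G\<close>, this says that \<open>G\<close> is a flat in the matroid
  of the complete graph on its own vertices; edges to new vertices are not tested.\<close>

definition closed :: "'v set set \<Rightarrow> bool" where
  "closed G \<longleftrightarrow> (\<forall>u\<in>verts G. \<forall>w\<in>verts G.
     u \<noteq> w \<and> rk (insert {u, w} G) = rk G \<longrightarrow> {u, w} \<in> G)"

text \<open>Spans grow with the set, so a nonedge of a closed graph is unspanned by every partial
  graph met while building it up.\<close>

lemma rk_insert_nonedge:
  assumes "graph G" "closed G" "F \<subseteq> G" "u \<in> verts G" "w \<in> verts G" "u \<noteq> w" "{u, w} \<notin> G"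
  shows "rk (insert {u, w} F) = Suc (rk F)"
proof -
  have fin: "finite G" "finite F" using assms graph_finite finite_subset by auto
  have "rk (insert {u, w} F) \<noteq> rk F"
    using rk_insert_span_mono[OF fin(1) assms(3)] assms unfolding closed_def by blast
  moreover have "rk F \<le> rk (insert {u, w} F)" using fin by (intro rk_mono) auto
  ultimately show ?thesis using rk_insert_le[OF fin(2), of "{u, w}"] by simp
qed

lemma closed_avoid:
  assumes "graph G" "closed G"
  shows "closed (avoid G X)"
  unfolding closed_def
proof (intro ballI impI)
  fix u w assume uw: "u \<in> verts (avoid G X)" "w \<in> verts (avoid G X)"
    "u \<noteq> w \<and> rk (insert {u, w} (avoid G X)) = rk (avoid G X)"
  then have V: "u \<in> verts G - X" "w \<in> verts G - X" using verts_avoid_subset by fast+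
  then have "{u, w} \<in> G"
    using rk_insert_nonedge[OF assms avoid_subset, of u w X] uw by force
  then show "{u, w} \<in> avoid G X" using V by (simp add: avoid_def)
qed

lemma closure_exists:
  assumes "graph G"
  obtains H where "G \<subseteq> H" "graph H" "verts H = verts G" "rk H = rk G" "closed H"
proof -
  let ?H = "{e \<in> complete (verts G). rk (insert e G) = rk G}"
  have K: "graph (complete (verts G))" by (rule graph_complete[OF finite_verts[OF assms]])
  have GH: "G \<subseteq> ?H"
    using subset_complete[OF assms subset_refl] by (auto simp: insert_absorb)
  have H: "graph ?H" using graph_subset[OF K] by auto
  have V: "verts ?H = verts G"
  proof
    show "verts ?H \<subseteq> verts G" by (auto simp: verts_def complete_def)
    show "verts G \<subseteq> verts ?H" by (rule verts_mono[OF GH])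
  qed
  have "rk (G \<union> ?H) = rk G"
    by (rule rk_span) (use graph_finite[OF assms] graph_finite[OF H] in auto)
  then have rk: "rk ?H = rk G" using GH by (simp add: Un_absorb1)
  have "closed ?H"
    unfolding closed_def V
  proof (intro ballI impI)
    fix u w assume uw: "u \<in> verts G" "w \<in> verts G" "u \<noteq> w \<and> rk (insert {u, w} ?H) = rk ?H"
    have "rk (insert {u, w} G) \<le> rk (insert {u, w} ?H)"
      using GH graph_finite[OF H] by (intro rk_mono) auto
    moreover have "rk G \<le> rk (insert {u, w} G)"
      using graph_finite[OF assms] by (intro rk_mono) auto
    ultimately have "rk (insert {u, w} G) = rk G" using uw rk by simp
    then show "{u, w} \<in> ?H" using uw by (simp add: complete_edge_iff)
  qed
  then show ?thesis using that[OF GH H V rk] by simp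
qed

text \<open>When \<open>z\<close> returns, \<open>f z\<close> and \<open>g z\<close> are already
  present. By closedness, their nonedge would raise the current rank by one, and
  \<open>rk_split_vertex\<close> turns this into a gain of \<open>d + 1\<close>.\<close>

lemma rk_split_vertices:
  assumes G: "graph G" "closed G" and Z: "finite Z" "Z \<subseteq> X"
    and deg: "\<And>v. v \<in> verts G \<Longrightarrow> Suc d \<le> card (nbrs G v - X)"
    and fg: "\<And>z. z \<in> Z \<Longrightarrow> {z, f z} \<in> G \<and> {z, g z} \<in> G \<and> f z \<noteq> g z \<and> {f z, g z} \<notin> G
      \<and> f z \<notin> X \<and> g z \<notin> X"
  shows "rk (avoid G X) + Suc d * card Z \<le> rk (avoid G (X - Z))"
  using Z fg
proof (induction Z)
  case (insert z Z)
  let ?H = "avoid G (X - insert z Z)"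
  have H: "graph ?H" by (rule graph_avoid[OF G(1)])
  have eq: "avoid ?H {z} = avoid G (X - Z)"
    using insert by (auto simp: avoid_def)
  have fgz: "{z, f z} \<in> G" "{z, g z} \<in> G" "f z \<noteq> g z" "{f z, g z} \<notin> G" "f z \<notin> X" "g z \<notin> X"
    using insert.prems(2)[of z] by auto
  have V: "z \<in> verts G" "f z \<in> verts G" "g z \<in> verts G"
    using fgz edge_in_verts by fast+
  have nH: "nbrs ?H z = nbrs G z - (X - insert z Z)" by (rule nbrs_avoid) simp
  have "card (nbrs G z - X) \<le> deg ?H z"
    unfolding deg_eq_card_nbrs[OF H] nH using finite_nbrs[OF G(1)] by (intro card_mono) auto
  then have degH: "Suc d \<le> deg ?H z" using deg[OF V(1)] by simp
  \<comment> \<open>No neighbour of \<open>z\<close> may be isolated before \<open>z\<close>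
    returns, since the edge split attaches only to existing vertices; its own neighbours outside
    \<open>X\<close> prevent this.\<close>
  have "nbrs ?H z \<subseteq> verts (avoid ?H {z})"
  proof
    fix y assume "y \<in> nbrs ?H z"
    then have y: "y \<in> nbrs G z" "y \<notin> X - insert z Z" using nH by auto
    then have "y \<noteq> z" "y \<in> verts G" using nbrs_subset[OF G(1), of z] by auto
    then have "0 < card (nbrs G y - X)" using deg[of y] by simp
    then obtain y' where "y' \<in> nbrs G y - X" by (metis card_gt_0_iff ex_in_conv)
    then have "{y, y'} \<in> avoid G (X - Z)"
      using y \<open>y \<noteq> z\<close> by (auto simp: nbrs_def avoid_def)
    then show "y \<in> verts (avoid ?H {z})" unfolding eq using edge_in_verts by fast
  qed
  then have "rk (insert {f z, g z} (avoid ?H {z})) + d \<le> rk ?H"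
    using fgz degH by (intro rk_split_vertex[OF H]) (auto simp: avoid_def)
  then have "Suc (rk (avoid G (X - Z))) + d \<le> rk ?H"
    unfolding eq using rk_insert_nonedge[OF G avoid_subset V(2,3) fgz(3,4)] by simp
  then show ?case using insert by simp
qed simp

text \<open>Build the graph up from a small dominating set. Each later vertex contributes at least
  \<open>d\<close> to the rank, and the vertices of a large stable set, each arriving after a pair of its
  nonadjacent neighbours, contribute \<open>d + 1\<close>.\<close>

lemma rk_closed_without_simplicial:
  assumes G: "graph G" "closed G" and ns: "\<And>v. v \<in> verts G \<Longrightarrow> \<not> simplicial G v"
    and deg: "\<And>v. v \<in> verts G \<Longrightarrow> Suc d + (2 * (10 * Suc d) * Suc d)\<^sup>2 \<le> deg G v"
  shows "(10 * d + 1) * card (verts G) \<le> 10 * rk G"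
proof -
  let ?V = "verts G"
  have finV: "finite ?V" by (rule finite_verts[OF G(1)])
  have "\<forall>v\<in>?V. \<exists>p. {v, fst p} \<in> G \<and> {v, snd p} \<in> G \<and> fst p \<noteq> snd p \<and> {fst p, snd p} \<notin> G"
    using ns unfolding simplicial_def by auto
  then obtain p where p: "\<And>v. v \<in> ?V \<Longrightarrow>
      {v, fst (p v)} \<in> G \<and> {v, snd (p v)} \<in> G \<and> fst (p v) \<noteq> snd (p v) \<and> {fst (p v), snd (p v)} \<notin> G"
    by metis
  define f g where "f v = fst (p v)" and "g v = snd (p v)" for v
  have fg: "{v, f v} \<in> G" "{v, g v} \<in> G" "f v \<noteq> g v" "{f v, g v} \<notin> G" if "v \<in> ?V" for v
    using p[OF that] by (auto simp: f_def g_def)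
  have "f v \<noteq> v \<and> g v \<noteq> v" if "v \<in> ?V" for v
    using fg[OF that] graph_edge_neq[OF G(1)] by metis
  then obtain Y where Y: "Y \<subseteq> ?V" "card ?V \<le> 5 * card Y" "\<And>v. v \<in> Y \<Longrightarrow> f v \<notin> Y \<and> g v \<notin> Y"
    using stable_set_of_two_maps[OF finV, of f g] by metis
  have "nbrs G v \<subseteq> ?V" for v using nbrs_subset[OF G(1)] by auto
  \<comment> \<open>The parameters make \<open>Suc d * card A\<close> at most a tenth of the vertex
    number. This is the loss incurred by starting from \<open>A\<close>, while the surplus
    \<open>card Y\<close> is at least a fifth.\<close>
  then obtain A where A: "A \<subseteq> ?V" "10 * Suc d * card A \<le> card ?V"
    "\<And>v. v \<in> ?V \<Longrightarrow> Suc d \<le> card (nbrs G v \<inter> A)"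
    using small_dominating_set[OF finV, of "nbrs G" "Suc d" "10 * Suc d"] deg
    unfolding deg_eq_card_nbrs[OF G(1)] by auto
  have dom: "Suc d \<le> card (nbrs G v - X)" if "v \<in> ?V" "X \<inter> A = {}" for v X
  proof -
    have "card (nbrs G v \<inter> A) \<le> card (nbrs G v - X)"
      using that finite_nbrs[OF G(1)] by (intro card_mono) auto
    then show ?thesis using A(3)[OF that(1)] by simp
  qed
  have finA: "finite A" and finY: "finite Y" using A Y finV finite_subset by auto
  have "rk (avoid G (?V - A)) + d * card (?V - A - Y) \<le> rk (avoid G (?V - A - (?V - A - Y)))"
  proof (rule rk_add_vertices[OF G(1)])
    fix z assume "z \<in> ?V - A - Y"
    then have "Suc d \<le> card (nbrs G z - (?V - A))" by (intro dom) auto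
    then show "d \<le> card (nbrs G z - (?V - A))" by simp
  qed (use finV in auto)
  moreover have "?V - A - (?V - A - Y) = Y - A" using Y by auto
  ultimately have "d * card (?V - A - Y) \<le> rk (avoid G (Y - A))" by simp
  \<comment> \<open>The vertices of \<open>Y - A\<close> come last. As \<open>Y\<close> avoids the
    values of \<open>f\<close> and \<open>g\<close> on \<open>Y\<close>, both chosen neighbours are
    present by then.\<close>
  moreover have "rk (avoid G (Y - A)) + Suc d * card (Y - A) \<le> rk (avoid G ((Y - A) - (Y - A)))"
  proof (rule rk_split_vertices[OF G, where f = f and g = g])
    fix v assume "v \<in> ?V"
    then show "Suc d \<le> card (nbrs G v - (Y - A))" by (intro dom) auto
  next
    fix z assume z: "z \<in> Y - A"
    then show "{z, f z} \<in> G \<and> {z, g z} \<in> G \<and> f z \<noteq> g z \<and> {f z, g z} \<notin> G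
      \<and> f z \<notin> Y - A \<and> g z \<notin> Y - A"
      using fg[of z] Y by auto
  qed (use finY in auto)
  ultimately have "d * card (?V - A - Y) + Suc d * card (Y - A) \<le> rk G" by simp
  then have *: "d * (card (?V - A - Y) + card (Y - A)) + card (Y - A) \<le> rk G"
    by (simp add: algebra_simps)
  have "card (?V - A - Y) + card (Y - A) = card ((?V - A - Y) \<union> (Y - A))"
    using finV finY by (subst card_Un_disjoint) auto
  also have "(?V - A - Y) \<union> (Y - A) = ?V - A" using Y by auto
  also have "card (?V - A) = card ?V - card A" using A finA by (intro card_Diff_subset) auto
  finally have sum: "card (?V - A - Y) + card (Y - A) + card A = card ?V"
    using card_mono[OF finV A(1)] by simp
  have YA: "card Y \<le> card (Y - A) + card A"
    using diff_card_le_card_Diff[OF finA, of Y] by simp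
  \<comment> \<open>Relative to a gain of \<open>d\<close> everywhere and one more on
    \<open>Y\<close>, each vertex of \<open>A\<close> may cost \<open>d\<close>, and one more if it
    lies in \<open>Y\<close>; hence the factor \<open>Suc d\<close>.\<close>
  have "d * card ?V + card Y = d * (card (?V - A - Y) + card (Y - A)) + d * card A + card Y"
    unfolding sum[symmetric] by (simp add: algebra_simps)
  also have "\<dots> \<le> rk G + Suc d * card A" using * YA by simp
  finally have "10 * d * card ?V + 10 * card Y \<le> 10 * rk G + 10 * Suc d * card A"
    by (simp add: algebra_simps)
  then have "10 * d * card ?V + 2 * card ?V \<le> 10 * rk G + card ?V" using A(2) Y(2) by linarith
  then show ?thesis by (simp add: algebra_simps)
qed

text \<open>The summands provide room for the template circuit, the degree needed for the small
  dominating set, and more vertices than the final rank comparison allows.\<close>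

definition rigid_conn :: nat where
  "rigid_conn = card base + Suc d + (2 * (10 * Suc d) * Suc d)\<^sup>2 + 10 * rk (complete base)"

text \<open>Without simplicial vertices the rank would be at least \<open>d + 1/10\<close> per
  vertex, exceeding that of the complete graph. Otherwise a simplicial vertex is removed, which
  preserves both closedness and the connectivity constant.\<close>

lemma closed_connected_complete:
  assumes "graph G" "closed G" "k_connected G rigid_conn"
  shows "G = complete (verts G)"
  using assms
proof (induction "card (verts G)" arbitrary: G rule: less_induct)
  case less
  note G = less.prems(1,2) and con = less.prems(3)
  have finV: "finite (verts G)" by (rule finite_verts[OF G(1)])
  have deg: "rigid_conn \<le> deg G v" if "v \<in> verts G" for v
    by (rule k_connected_deg[OF G(1) con that])
  show ?case
  proof (cases "card (verts G) \<le> Suc rigid_conn")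
    case True
    then show ?thesis using k_connected_small_complete[OF G(1) con] by simp
  next
    case False
    have "\<exists>x\<in>verts G. simplicial G x"
    proof (rule ccontr)
      assume "\<not> ?thesis"
      then have "(10 * d + 1) * card (verts G) \<le> 10 * rk G"
        using deg by (intro rk_closed_without_simplicial[OF G]) (force simp: rigid_conn_def)+
      also have "rk G \<le> rk (complete (verts G))"
        using subset_complete[OF G(1)] graph_finite[OF graph_complete[OF finV]]
        by (intro rk_mono) auto
      also have "\<dots> \<le> rk (complete base) + d * card (verts G)"
        using False by (intro rk_complete_le[OF finV]) (simp add: rigid_conn_def)
      finally have "card (verts G) \<le> 10 * rk (complete base)" by (simp add: algebra_simps)
      then show False using False by (simp add: rigid_conn_def)
    qed
    then obtain x where x: "x \<in> verts G" "simplicial G x" by blast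
    let ?H = "avoid G {x}"
    have two: "2 \<le> rigid_conn" using card_base by (simp add: rigid_conn_def)
    have VH: "verts ?H = verts G - {x}"
      by (rule verts_avoid[OF G(1) con]) (use two in auto)
    have "k_connected ?H rigid_conn"
      using False two x by (intro k_connected_remove_simplicial[OF G(1) con]) auto
    moreover have "card (verts ?H) < card (verts G)"
      unfolding VH by (rule card_Diff1_less[OF finV x(1)])
    ultimately have "?H = complete (verts ?H)"
      by (intro less.hyps closed_avoid[OF G] graph_avoid[OF G(1)])
    then have sub: "complete (verts G - {x}) \<subseteq> G"
      using VH avoid_subset[of G "{x}"] by metis
    \<comment> \<open>The rest is complete by induction and \<open>x\<close> has \<open>d\<close>
      neighbours in it, so all edges at \<open>x\<close> are spanned and closedness puts them into
      \<open>G\<close>.\<close>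
    have xu: "{x, u} \<in> G" if u: "u \<in> verts G - {x}" for u
    proof -
      have "d \<le> card (nbrs G x)"
        using deg[OF x(1)] by (simp add: deg_eq_card_nbrs[OF G(1)] rigid_conn_def)
      then obtain S where S: "S \<subseteq> nbrs G x" "card S = d"
        using obtain_subset_with_card_n[of d "nbrs G x"] by auto
      let ?F = "complete (verts G - {x}) \<union> (\<lambda>s. {x, s}) ` S"
      have "rk (insert {x, u} ?F) = rk ?F"
      proof (rule rk_complete_insert_span)
        show "S \<subseteq> verts G - {x}" using S nbrs_subset[OF G(1)] by blast
        show "card base \<le> Suc (card (verts G - {x}))"
          using False x finV by (simp add: rigid_conn_def)
      qed (use finV S u in auto)
      moreover have "?F \<subseteq> G" using sub S by (auto simp: nbrs_def)
      ultimately have "rk (insert {x, u} G) = rk G"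
        using rk_insert_span_mono[OF graph_finite[OF G(1)]] by blast
      then show ?thesis using G(2) x(1) u unfolding closed_def by auto
    qed
    have "complete (verts G) = complete (insert x (verts G - {x}))"
      using insert_Diff[OF x(1)] by simp
    also have "\<dots> = complete (verts G - {x}) \<union> (\<lambda>u. {x, u}) ` (verts G - {x})"
      by (rule complete_insert) simp
    also have "\<dots> \<subseteq> G" using sub xu by auto
    finally show ?thesis using subset_complete[OF G(1) subset_refl] by (rule subset_antisym[rotated])
  qed
qed

lemma connected_rk:
  assumes "graph G" "k_connected G rigid_conn"
  shows "rk G = rk (complete (verts G))"
proof -
  obtain H where H: "G \<subseteq> H" "graph H" "verts H = verts G" "rk H = rk G" "closed H"
    using closure_exists[OF assms(1)] .
  have "k_connected H rigid_conn" by (rule k_connected_mono[OF assms(2) H(1,3)])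
  then have "H = complete (verts H)" using closed_connected_complete H by blast
  then show ?thesis using H by simp
qed

subsection \<open>Highly connected graphs are reconstructible\<close>

lemma rigid_conn_ge: "card base \<le> rigid_conn" "2 * d \<le> rigid_conn" "1 \<le> rigid_conn"
  using card_base by (auto simp: rigid_conn_def)

lemma connected_rk_formula:
  assumes "graph G" "k_connected G rigid_conn"
  shows "rk G + d * card base = rk (complete base) + d * card (verts G)"
proof -
  have "card base \<le> card (verts G)"
    using assms(2) rigid_conn_ge(1) by (simp add: k_connected_iff)
  then show ?thesis
    using rk_complete[OF finite_verts[OF assms(1)]] connected_rk[OF assms] by simp
qed

text \<open>Both the graph and what remains after the deletion are rigid, so their ranks are
  determined by their vertex numbers.\<close>

lemma rk_avoid_connected:
  assumes "graph G" "k_connected G (rigid_conn + card T)" "T \<subseteq> verts G"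
  shows "rk G = rk (avoid G T) + d * card T"
proof -
  have finV: "finite (verts G)" by (rule finite_verts[OF assms(1)])
  have finT: "finite T" using assms(3) finV finite_subset by blast
  have "verts (avoid G T) = verts G - T"
    by (rule verts_avoid[OF assms(1,2) finT]) (use rigid_conn_ge in auto)
  then have card: "card (verts (avoid G T)) + card T = card (verts G)"
    using card_Diff_subset[OF finT assms(3)] card_mono[OF finV assms(3)] by simp
  have "k_connected (avoid G T) rigid_conn"
    by (rule k_connected_avoid[OF assms rigid_conn_ge(3)])
  then have "rk (avoid G T) + d * card base = rk (complete base) + d * card (verts (avoid G T))"
    by (rule connected_rk_formula[OF graph_avoid[OF assms(1)]])
  moreover have "rk G + d * card base = rk (complete base) + d * card (verts G)"
    by (rule connected_rk_formula[OF assms(1) k_connected_le[OF assms(2)]]) simp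
  ultimately show ?thesis unfolding card[symmetric] by (simp add: algebra_simps)
qed

text \<open>A vertex incident with both parts has degree at least \<open>d\<close> in one of them, so its deletion
  lowers \<open>rk A + rk B\<close> by at least \<open>d + 1\<close>, but \<open>rk G\<close> only by \<open>d\<close>.\<close>

lemma separation_vertex_cover:
  assumes "graph G" "k_connected G (rigid_conn + k)" "G = A \<union> B" "rk A + rk B < rk G + k"
  obtains T where "T \<subseteq> verts G" "card T \<le> k" "avoid A T = {} \<or> avoid B T = {}"
proof -
  have "\<exists>T\<subseteq>verts G. card T \<le> k \<and> (avoid A T = {} \<or> avoid B T = {})"
    using assms
  proof (induction k arbitrary: G A B)
    case 0
    have "finite A" "finite B" using 0 graph_finite by auto
    then have "rk G \<le> rk A + rk B" using rk_submodular[of A B] 0 by simp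
    then show ?case using 0 by simp
  next
    case (Suc k)
    note G = Suc.prems(1) and con = Suc.prems(2) and AB = Suc.prems(3)
    show ?case
    proof (cases "A = {} \<or> B = {}")
      case True
      then show ?thesis by (intro exI[of _ "{}"]) auto
    next
      case False
      have "connected_on (verts G - {}) (avoid G {})"
        using con unfolding k_connected_iff by (elim conjE allE[of _ "{}"]) simp
      then have "connected_on (verts G) G" by simp
      moreover have "{} \<notin> G" using G by (auto simp: graph_def)
      ultimately obtain v where v: "v \<in> verts A" "v \<in> verts B"
        using connected_common_vertex[OF _ AB] False by metis
      have gA: "graph A" "graph B" using G AB graph_subset by auto
      have vG: "v \<in> verts G" using v AB verts_mono[of A G] by auto
      have pos: "1 \<le> deg A v" "1 \<le> deg B v"
        using v verts_eq_nbrs[OF gA(1)] verts_eq_nbrs[OF gA(2)] finite_nbrs[OF gA(1)] finite_nbrs[OF gA(2)]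
        by (auto simp: deg_eq_card_nbrs[OF gA(1)] deg_eq_card_nbrs[OF gA(2)] Suc_le_eq card_gt_0_iff)
      have "deg G v \<le> deg A v + deg B v"
      proof -
        have "{e \<in> G. v \<in> e} = {e \<in> A. v \<in> e} \<union> {e \<in> B. v \<in> e}" using AB by auto
        then show ?thesis unfolding deg_def by (metis card_Un_le)
      qed
      moreover have "2 * d \<le> deg G v"
      proof -
        show ?thesis using k_connected_deg[OF G con vG] rigid_conn_ge(2) by simp
      qed
      ultimately have "d + 1 \<le> min d (deg A v) + min d (deg B v)"
        using pos d_pos by linarith
      moreover have "rk (avoid A {v}) + min d (deg A v) \<le> rk A"
        "rk (avoid B {v}) + min d (deg B v) \<le> rk B"
        using rk_add_vertex gA by auto
      moreover have "rk G = rk (avoid G {v}) + d"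
      proof -
        have "rk G = rk (avoid G {v}) + d * card {v}"
          by (rule rk_avoid_connected[OF G k_connected_le[OF con]]) (use vG in auto)
        then show ?thesis by simp
      qed
      ultimately have "rk (avoid A {v}) + rk (avoid B {v}) < rk (avoid G {v}) + k"
        using Suc.prems(4) by linarith
      moreover have "k_connected (avoid G {v}) (rigid_conn + k)"
        by (rule k_connected_avoid[OF G]) (use con vG rigid_conn_ge in auto)
      moreover have "avoid G {v} = avoid A {v} \<union> avoid B {v}" using AB by (auto simp: avoid_def)
      ultimately obtain T where T: "T \<subseteq> verts (avoid G {v})" "card T \<le> k"
          "avoid (avoid A {v}) T = {} \<or> avoid (avoid B {v}) T = {}"
        using Suc.IH[OF graph_avoid[OF G], of "{v}" "avoid A {v}" "avoid B {v}"] by blast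
      have "insert v T \<subseteq> verts G" using T(1) vG verts_avoid_subset[of G "{v}"] by auto
      moreover have "card (insert v T) \<le> Suc k"
        using card_insert_le_m1[of "Suc k" T v] T(2) by simp
      moreover have "avoid A (insert v T) = {} \<or> avoid B (insert v T) = {}"
        using T(3) by (simp add: avoid_avoid)
      ultimately show ?thesis by blast
    qed
  qed
  then show ?thesis using that by blast
qed

text \<open>After deleting the cover \<open>T\<close>, one part contains all remaining edges and so
  has rank at least \<open>rk G - d * k\<close>. Little is then left for the other part.\<close>

lemma vertically_connected:
  assumes "graph G" "k_connected G (rigid_conn + k)" "G = A \<union> B" "rk A + rk B < rk G + k"
  shows "rk A \<le> Suc d * k \<or> rk B \<le> Suc d * k"
proof -
  obtain T where T: "T \<subseteq> verts G" "card T \<le> k" "avoid A T = {} \<or> avoid B T = {}"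
    using separation_vertex_cover[OF assms] .
  have fin: "finite A" "finite B" using assms graph_finite by auto
  have "rk G = rk (avoid G T) + d * card T"
    using T by (intro rk_avoid_connected[OF assms(1) k_connected_le[OF assms(2)]]) auto
  moreover have "d * card T \<le> d * k" using T(2) by (rule mult_le_mono2)
  moreover have "avoid G T = avoid A T \<union> avoid B T" using assms(3) by (auto simp: avoid_def)
  then have "avoid G T \<subseteq> B \<or> avoid G T \<subseteq> A"
    using T(3) avoid_subset[of A T] avoid_subset[of B T] by auto
  then have "rk (avoid G T) \<le> rk B \<or> rk (avoid G T) \<le> rk A"
    using rk_mono fin by blast
  moreover have "Suc d * k = k + d * k" by simp
  ultimately show ?thesis using assms(4) by linarith
qed

section \<open>Rank-preserving bijections\<close>

definition rk_iso :: "('v set \<Rightarrow> 'v set) \<Rightarrow> 'v set set \<Rightarrow> 'v set set \<Rightarrow> bool" where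
  "rk_iso \<psi> G H \<longleftrightarrow> bij_betw \<psi> G H \<and> (\<forall>F\<subseteq>G. rk (\<psi> ` F) = rk F)"

lemma rk_isoI:
  assumes "graph G" "graph H" "bij_betw \<psi> G H" "\<And>F. F \<subseteq> G \<Longrightarrow> M G F \<longleftrightarrow> M H (\<psi> ` F)"
  shows "rk_iso \<psi> G H"
  unfolding rk_iso_def
proof (intro conjI allI impI)
  fix F assume F: "F \<subseteq> G"
  have inj: "inj_on \<psi> G" and img: "\<psi> ` G = H" using assms(3) by (auto simp: bij_betw_def)
  have sub: "\<psi> ` E \<subseteq> H" if "E \<subseteq> G" for E using that img by auto
  have ind: "ind (\<psi> ` E) \<longleftrightarrow> ind E" if "E \<subseteq> G" for E
    using assms(4)[OF that] M_iff_ind[OF assms(1) that] M_iff_ind[OF assms(2) sub[OF that]] by simp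
  have card: "card (\<psi> ` E) = card E" if "E \<subseteq> G" for E
    using inj_on_subset[OF inj that] by (rule card_image)
  have "card ` {E. E \<subseteq> \<psi> ` F \<and> ind E} = card ` {E. E \<subseteq> F \<and> ind E}"
  proof (intro equalityI subsetI)
    fix n assume "n \<in> card ` {E. E \<subseteq> \<psi> ` F \<and> ind E}"
    then obtain E where E: "E \<subseteq> \<psi> ` F" "ind E" "n = card E" by auto
    then obtain E' where E': "E' \<subseteq> F" "E = \<psi> ` E'" by (meson subset_imageE)
    then have "E' \<subseteq> G" using F by auto
    then show "n \<in> card ` {E. E \<subseteq> F \<and> ind E}"
      using E E' ind[of E'] card[of E'] by (intro image_eqI[of _ _ E']) auto
  next
    fix n assume "n \<in> card ` {E. E \<subseteq> F \<and> ind E}"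
    then obtain E where E: "E \<subseteq> F" "ind E" "n = card E" by auto
    then have "E \<subseteq> G" using F by auto
    then show "n \<in> card ` {E. E \<subseteq> \<psi> ` F \<and> ind E}"
      using E ind[of E] card[of E] by (intro image_eqI[of _ _ "\<psi> ` E"]) auto
  qed
  then show "rk (\<psi> ` F) = rk F" by (simp add: rk_def)
qed (rule assms)

lemma rk_iso_rk: "rk_iso \<psi> G H \<Longrightarrow> rk H = rk G"
  by (auto simp: rk_iso_def bij_betw_def)

text \<open>Immediate because \<open>rk\<close> refers to no ambient graph; it permits applying
  results on \<open>G\<close> and \<open>H\<close> to a vertex-deleted subgraph and its
  image.\<close>

lemma rk_iso_subset:
  assumes "rk_iso \<psi> G H" "F \<subseteq> G"
  shows "rk_iso \<psi> F (\<psi> ` F)"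
  using assms unfolding rk_iso_def by (auto intro: bij_betw_subset)

text \<open>Removing the star of \<open>w\<close> lowers the rank of \<open>H\<close>. If the star
  were small, its preimage \<open>D\<close> would consist of at most \<open>t\<close> edges, but
  deleting so few edges cannot lower the rank of the highly connected \<open>G\<close>.\<close>

lemma rk_iso_deg:
  assumes G: "graph G" "graph H" and iso: "rk_iso \<psi> G H"
    and con: "k_connected G (rigid_conn + 2 * t)" and w: "w \<in> verts H"
  shows "t < deg H w"
proof (rule ccontr)
  assume small: "\<not> t < deg H w"
  define D where "D = {e \<in> G. w \<in> \<psi> e}"
  have inj: "inj_on \<psi> G" and img: "\<psi> ` G = H" and rk: "\<And>F. F \<subseteq> G \<Longrightarrow> rk (\<psi> ` F) = rk F"
    using iso by (auto simp: rk_iso_def bij_betw_def)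
  have DG: "D \<subseteq> G" by (auto simp: D_def)
  have imD: "\<psi> ` D = {e \<in> H. w \<in> e}" using img by (auto simp: D_def)
  have imGD: "\<psi> ` (G - D) = avoid H {w}" using img by (auto simp: D_def avoid_def)
  have cD: "card D \<le> t"
    using small card_image[OF inj_on_subset[OF inj DG]] by (simp add: deg_def imD)
  have finD: "finite D" using DG graph_finite[OF G(1)] finite_subset by blast
  have "1 \<le> deg H w"
    using w verts_eq_nbrs[OF G(2)] finite_nbrs[OF G(2), of w]
    by (simp add: deg_eq_card_nbrs[OF G(2)] Suc_le_eq card_gt_0_iff)
  then have "rk (avoid H {w}) < rk H" using rk_add_vertex[OF G(2), of w] d_pos by linarith
  then have less: "rk (G - D) < rk G"
    using rk[of "G - D"] rk[of G] imGD img by simp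
  \<comment> \<open>One end of each edge of \<open>D\<close>: deleting these vertices also deletes
    \<open>D\<close>, and they are then put back without it.\<close>
  define T where "T = (\<lambda>e. SOME v. v \<in> e) ` D"
  have some: "(SOME v. v \<in> e) \<in> e" if "e \<in> D" for e
  proof -
    have "card e = 2" using that DG G(1) by (auto simp: graph_def)
    then have "e \<noteq> {}" by auto
    then show ?thesis by (simp add: some_in_eq)
  qed
  have TV: "T \<subseteq> verts G" using some DG by (auto simp: T_def verts_def)
  have finT: "finite T" using finD by (simp add: T_def)
  have cT: "card T \<le> t" using card_image_le[OF finD, of "\<lambda>e. SOME v. v \<in> e"] cD by (simp add: T_def)
  have "e \<inter> T \<noteq> {}" if "e \<in> D" for e using some[OF that] that by (auto simp: T_def)
  then have av: "avoid (G - D) T = avoid G T" by (auto simp: avoid_def)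
  have gGD: "graph (G - D)" using graph_subset[OF G(1)] by auto
  \<comment> \<open>A vertex of \<open>T\<close> has at least \<open>rigid_conn + 2 * t\<close>
    neighbours in \<open>G\<close>. At most \<open>t\<close> are lost through \<open>D\<close> and
    at most \<open>t\<close> lie in \<open>T\<close>, so at least \<open>d\<close> remain.\<close>
  have "rk (avoid (G - D) T) + d * card T \<le> rk (avoid (G - D) (T - T))"
  proof (rule rk_add_vertices[OF gGD finT])
    fix z assume z: "z \<in> T"
    let ?N = "nbrs G z" and ?Q = "nbrs D z"
    have "rigid_conn + 2 * t \<le> card ?N"
      using k_connected_deg[OF G(1) con, of z] z TV by (auto simp: deg_eq_card_nbrs[OF G(1)])
    moreover have "card ?Q \<le> t"
    proof -
      have "card ?Q = card ((\<lambda>u. {z, u}) ` ?Q)" by (rule card_image[OF inj_on_star, symmetric])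
      also have "\<dots> \<le> card D" using finD by (intro card_mono) (auto simp: nbrs_def)
      finally show ?thesis using cD by simp
    qed
    moreover have "card (?Q \<union> T) \<le> card ?Q + card T" by (rule card_Un_le)
    moreover have "finite ?Q" using finite_nbrs[OF graph_subset[OF G(1) DG]] .
    then have "card ?N - card (?Q \<union> T) \<le> card (?N - (?Q \<union> T))"
      using finT by (intro diff_card_le_card_Diff) auto
    moreover have "nbrs (G - D) z - T = ?N - (?Q \<union> T)" by (auto simp: nbrs_def)
    ultimately show "d \<le> card (nbrs (G - D) z - T)" using cT rigid_conn_ge(2) by simp
  qed simp
  moreover have "rk G = rk (avoid G T) + d * card T"
    using cT TV by (intro rk_avoid_connected[OF G(1) k_connected_le[OF con]]) auto
  ultimately show False using less av by simp
qed

text \<open>Start from \<open>V1\<close> and \<open>d\<close> vertices of \<open>V2 - V1\<close>.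
  Every other vertex of \<open>V2 - V1\<close> is adjacent to these and gains \<open>d\<close>; the
  \<open>d\<close> starting vertices are counted as gaining nothing, whence
  \<open>d * d\<close>.\<close>

lemma rk_complete_overlap:
  assumes "finite V1" "finite V2" "card base \<le> card V2" "d \<le> card (V2 - V1)"
  shows "rk (complete V1) + rk (complete V2) \<le>
    rk (complete V1 \<union> complete V2) + rk (complete base) + d * card (V1 \<inter> V2) + d * d"
proof -
  let ?G = "complete V1 \<union> complete V2" and ?Q = "V2 - V1"
  have G: "graph ?G" using assms graph_complete graph_Un by blast
  obtain S where S: "S \<subseteq> ?Q" "card S = d"
    using obtain_subset_with_card_n[OF assms(4)] by auto
  have finS: "finite S" using S assms finite_subset[of S V2] by auto
  have "rk (avoid ?G (?Q - S)) + d * card (?Q - S) \<le> rk (avoid ?G ((?Q - S) - (?Q - S)))"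
  proof (rule rk_add_vertices[OF G])
    fix z assume z: "z \<in> ?Q - S"
    have "card S \<le> card (nbrs ?G z - (?Q - S))"
      using z S finite_nbrs[OF G, of z] by (intro card_mono) (auto simp: nbrs_def complete_edge_iff)
    then show "d \<le> card (nbrs ?G z - (?Q - S))" using S by simp
  qed (use assms in auto)
  moreover have "complete V1 \<subseteq> avoid ?G (?Q - S)" by (auto simp: avoid_def complete_def)
  then have "rk (complete V1) \<le> rk (avoid ?G (?Q - S))"
    using graph_finite[OF graph_avoid[OF G]] by (intro rk_mono) auto
  moreover have "card (?Q - S) + d = card ?Q"
    using card_Diff_subset[OF finS S(1)] S assms(2) card_mono[of ?Q S] by simp
  then have "d * card (?Q - S) + d * d = d * card ?Q" by (simp add: add_mult_distrib2[symmetric])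
  moreover have "card V2 = card ?Q + card (V1 \<inter> V2)"
    using card_Diff_subset_Int[of V2 V1] assms(1,2) card_mono[of V2 "V1 \<inter> V2"]
    by (simp add: Int_commute)
  then have "d * card V2 = d * card ?Q + d * card (V1 \<inter> V2)" by (simp add: add_mult_distrib2)
  moreover have "rk (complete V2) \<le> rk (complete base) + d * card V2"
    by (rule rk_complete_le[OF assms(2,3)])
  ultimately show ?thesis by simp
qed

text \<open>Strict bound on the local connectivity of two complete graphs overlapping in fewer than
  \<open>rigid_conn\<close> vertices; the summand \<open>1\<close> makes it strict.\<close>

definition overlap_bound :: nat where
  "overlap_bound = rk (complete base) + d * rigid_conn + d * d + 1"

text \<open>Chosen so that, by \<open>rk_iso_deg\<close>, degrees in the image exceed the bound
  \<open>Suc d * overlap_bound\<close> on the rank of the smaller part in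
  \<open>vertically_connected\<close>.\<close>

definition iso_conn :: nat where
  "iso_conn = rigid_conn + 2 * (Suc d * overlap_bound)"

lemma overlap_bound_ge: "rigid_conn + d \<le> overlap_bound"
proof -
  have "1 * rigid_conn \<le> d * rigid_conn" "1 * d \<le> d * d"
    using d_pos by (intro mult_le_mono1; simp)+
  then show ?thesis unfolding overlap_bound_def by linarith
qed

text \<open>A small vertex cut of \<open>H\<close> splits its edges into two parts of low
  connectivity, each containing a full star and thus of large rank by \<open>rk_iso_deg\<close> and
  \<open>deg_le_rk\<close>. Pulled back to \<open>G\<close>, this contradicts
  \<open>vertically_connected\<close>.\<close>

lemma rk_iso_connected:
  assumes G: "graph G" "graph H" and iso: "rk_iso \<psi> G H" and con: "k_connected G iso_conn"
  shows "k_connected H rigid_conn"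
proof -
  let ?t = "Suc d * overlap_bound" and ?V = "verts H"
  have finV: "finite ?V" by (rule finite_verts[OF G(2)])
  have deg: "?t < deg H w" if "w \<in> ?V" for w
    using rk_iso_deg[OF G iso _ that] con by (simp add: iso_conn_def)
  have t: "rigid_conn + d \<le> ?t" using overlap_bound_ge by simp
  have "verts G \<noteq> {}" using con by (auto simp: k_connected_iff)
  then have "G \<noteq> {}" by (auto simp: verts_def)
  then have "H \<noteq> {}" using iso by (auto simp: rk_iso_def bij_betw_def)
  then obtain e where e: "e \<in> H" by blast
  moreover from this have "e \<noteq> {}" using G(2) by (auto simp: graph_def)
  ultimately obtain w where w: "w \<in> ?V" by (auto simp: verts_def)
  have large: "Suc (deg H w) \<le> card V" if "insert w (nbrs H w) \<subseteq> V" "finite V" for w V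
  proof -
    have "w \<notin> nbrs H w" using nbrs_subset[OF G(2)] by auto
    then have "card (insert w (nbrs H w)) = Suc (deg H w)"
      using finite_nbrs[OF G(2)] by (simp add: deg_eq_card_nbrs[OF G(2)])
    then show ?thesis using card_mono[OF that(2,1)] by simp
  qed
  have "Suc (deg H w) \<le> card ?V" using w nbrs_subset[OF G(2)] finV by (intro large) auto
  then have cV: "rigid_conn + 1 \<le> card ?V" using deg[OF w] t by linarith
  have "connected_on (?V - X) (avoid H X)" if X: "X \<subseteq> ?V" "card X < rigid_conn" for X
  proof (rule ccontr)
    assume not: "\<not> connected_on (?V - X) (avoid H X)"
    let ?R = "{(a, b). {a, b} \<in> avoid H X}"
    have finX: "finite X" using X finV finite_subset by blast
    have "card X < card ?V" using cV X by simp
    then have "?V - X \<noteq> {}" using card_mono[OF finX, of ?V] by auto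
    then obtain x y where xy: "x \<in> ?V - X" "y \<in> ?V - X" "(x, y) \<notin> ?R\<^sup>*"
      using not unfolding connected_on_def by auto
    define P where "P = {z \<in> ?V - X. (x, z) \<in> ?R\<^sup>*}"
    have P_step: "b \<in> P" if "{a, b} \<in> H" "a \<in> P" "b \<notin> X" for a b
    proof -
      have "(a, b) \<in> ?R" using that by (auto simp: avoid_def P_def)
      then show ?thesis
        using that edge_in_verts[OF that(1)] by (auto simp: P_def intro: rtrancl_into_rtrancl)
    qed
    \<comment> \<open>\<open>P\<close> is the component of \<open>x\<close> after deleting
      \<open>X\<close>. The two parts lie in complete graphs whose vertex sets share only
      \<open>X\<close>, so \<open>rk_complete_overlap\<close> bounds their connectivity.\<close>
    define A B where "A = {e \<in> H. e \<inter> P \<noteq> {}}" and "B = {e \<in> H. e \<inter> P = {}}"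
    let ?V1 = "P \<union> X" and ?V2 = "?V - P"
    have xP: "x \<in> P" and yP: "y \<notin> P" using xy by (auto simp: P_def)
    have HAB: "H = A \<union> B" by (auto simp: A_def B_def)
    have gA: "graph A" "graph B" using graph_subset[OF G(2)] HAB by auto
    have A: "A \<subseteq> complete ?V1"
    proof (rule subset_complete[OF gA(1)], rule subsetI)
      fix b assume "b \<in> verts A"
      then obtain e where e: "e \<in> H" "e \<inter> P \<noteq> {}" "b \<in> e" by (auto simp: verts_def A_def)
      then obtain a where a: "a \<in> e" "a \<in> P" by auto
      then obtain c where c: "e = {a, c}" by (metis graph_edgeE[OF G(2) e(1)])
      then show "b \<in> ?V1" using P_step[of a c] e a by auto
    qed
    have B: "B \<subseteq> complete ?V2"
      by (rule subset_complete[OF gA(2)]) (auto simp: verts_def B_def)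
    have ny: "nbrs H y \<inter> P = {}"
    proof (rule ccontr)
      assume "nbrs H y \<inter> P \<noteq> {}"
      then obtain u where "{u, y} \<in> H" "u \<in> P" by (auto simp: nbrs_def insert_commute)
      then show False using P_step[of u y] xy yP by auto
    qed
    have "Suc (deg H y) \<le> card ?V2"
      using ny yP xy nbrs_subset[OF G(2), of y] finV by (intro large) auto
    then have c2: "Suc ?t \<le> card ?V2" using deg[of y] xy by simp
    have int: "?V1 \<inter> ?V2 = X" and dif: "?V2 - ?V1 = ?V2 - X" using X by (auto simp: P_def)
    have "rk (complete ?V1) + rk (complete ?V2) \<le>
        rk (complete ?V1 \<union> complete ?V2) + rk (complete base) + d * card (?V1 \<inter> ?V2) + d * d"
    proof (rule rk_complete_overlap)
      show "finite ?V1" using finX finV by (auto simp: P_def)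
      show "card base \<le> card ?V2" using c2 t rigid_conn_ge(1) by linarith
      have "card ?V2 - card X \<le> card (?V2 - X)" by (rule diff_card_le_card_Diff[OF finX])
      then show "d \<le> card (?V2 - ?V1)" unfolding dif using c2 t X by linarith
    qed (use finV in simp)
    moreover have "rk A + rk B + rk (complete ?V1 \<union> complete ?V2) \<le>
        rk (complete ?V1) + rk (complete ?V2) + rk (A \<union> B)"
      using A B finX finV
      by (intro local_connectivity_mono graph_finite[OF graph_complete]) (auto simp: P_def)
    moreover have "d * card X \<le> d * rigid_conn" using X by simp
    ultimately have sep: "rk A + rk B < rk H + overlap_bound"
      unfolding int HAB[symmetric] overlap_bound_def by linarith
    define A' B' where "A' = {e \<in> G. \<psi> e \<in> A}" and "B' = {e \<in> G. \<psi> e \<in> B}"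
    have img: "\<psi> ` G = H" and rk: "\<And>F. F \<subseteq> G \<Longrightarrow> rk (\<psi> ` F) = rk F"
      using iso by (auto simp: rk_iso_def bij_betw_def)
    have "A \<subseteq> \<psi> ` G" "B \<subseteq> \<psi> ` G" using img HAB by auto
    then have "\<psi> ` A' = A" "\<psi> ` B' = B" unfolding A'_def B'_def by blast+
    then have rA: "rk A' = rk A" "rk B' = rk B"
      using rk[of A'] rk[of B'] by (auto simp: A'_def B'_def)
    have "G = A' \<union> B'" using img HAB by (auto simp: A'_def B'_def)
    then have "rk A' \<le> ?t \<or> rk B' \<le> ?t"
      using sep rA rk_iso_rk[OF iso]
      by (intro vertically_connected[OF G(1) k_connected_le[OF con]]) (auto simp: iso_conn_def)
    moreover have "deg A x = deg H x"
      using xP unfolding deg_def A_def by (intro arg_cong[where f = card]) auto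
    moreover have "deg B y = deg H y"
    proof -
      have "e \<inter> P = {}" if e: "e \<in> H" "y \<in> e" for e
      proof -
        obtain u where "e = {y, u}" by (metis graph_edgeE[OF G(2) e])
        then show ?thesis using e ny yP by (auto simp: nbrs_def)
      qed
      then show ?thesis unfolding deg_def B_def by (intro arg_cong[where f = card]) auto
    qed
    ultimately show False
      using deg[of x] deg[of y] xy deg_le_rk[OF gA(1), of x] deg_le_rk[OF gA(2), of y] rA by auto
  qed
  then show ?thesis using cV by (simp add: k_connected_iff)
qed

text \<open>By the rank formula and the positivity of \<open>d\<close>, the rank of a highly
  connected graph determines its number of vertices.\<close>

lemma rk_iso_card_verts:
  assumes "graph G" "graph H" "rk_iso \<psi> G H" "k_connected G iso_conn"
  shows "card (verts H) = card (verts G)"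
proof -
  have "rk G + d * card base = rk (complete base) + d * card (verts G)"
    by (rule connected_rk_formula[OF assms(1) k_connected_le[OF assms(4)]]) (simp add: iso_conn_def)
  moreover have "rk H + d * card base = rk (complete base) + d * card (verts H)"
    by (rule connected_rk_formula[OF assms(2) rk_iso_connected[OF assms]])
  ultimately show ?thesis using rk_iso_rk[OF assms(3)] d_pos by simp
qed

text \<open>\<open>G\<close> without \<open>v\<close> is still highly connected, so its image has
  one vertex fewer than \<open>H\<close> and misses some \<open>w\<close>. The image therefore
  avoids the star of \<open>w\<close>, and a rank comparison shows that it is all of
  \<open>avoid H {w}\<close>.\<close>

lemma rk_iso_star:
  assumes G: "graph G" "graph H" and iso: "rk_iso \<psi> G H" and con: "k_connected G (Suc iso_conn)"
    and v: "v \<in> verts G"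
  shows "\<exists>w\<in>verts H. \<psi> ` {e \<in> G. v \<in> e} = {e \<in> H. w \<in> e}"
proof -
  let ?F = "avoid G {v}"
  let ?H = "\<psi> ` ?F"
  have inj: "inj_on \<psi> G" and img: "\<psi> ` G = H" and rk: "\<And>F. F \<subseteq> G \<Longrightarrow> rk (\<psi> ` F) = rk F"
    using iso by (auto simp: rk_iso_def bij_betw_def)
  have finV: "finite (verts H)" by (rule finite_verts[OF G(2)])
  have sub: "?F \<subseteq> G" "?H \<subseteq> H" using avoid_subset[of G "{v}"] img by auto
  have gH: "graph ?H" by (rule graph_subset[OF G(2) sub(2)])
  have one: "1 \<le> iso_conn" using rigid_conn_ge(3) by (simp add: iso_conn_def)
  have conF: "k_connected ?F iso_conn"
    by (rule k_connected_avoid[OF G(1)]) (use con v one in auto)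
  have "verts ?F = verts G - {v}"
    by (rule verts_avoid[OF G(1) con]) (use one in auto)
  then have "card (verts ?F) < card (verts G)"
    using card_Diff1_less[OF finite_verts[OF G(1)] v] by simp
  moreover have "card (verts ?H) = card (verts ?F)"
    by (rule rk_iso_card_verts[OF graph_avoid[OF G(1)] gH rk_iso_subset[OF iso sub(1)] conF])
  moreover have "card (verts H) = card (verts G)"
    by (rule rk_iso_card_verts[OF G iso k_connected_le[OF con]]) simp
  ultimately have "card (verts ?H) < card (verts H)" by simp
  then have "verts ?H \<noteq> verts H" by auto
  then obtain w where w: "w \<in> verts H" "w \<notin> verts ?H"
    using verts_mono[OF sub(2)] by auto
  have Hw: "?H \<subseteq> avoid H {w}" using w(2) sub(2) by (auto simp: avoid_def verts_def)
  have degw: "d \<le> deg H w"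
  proof -
    have "k_connected G (rigid_conn + 2 * d)"
    proof (rule k_connected_le[OF con])
      have "1 * d \<le> Suc d * overlap_bound" using overlap_bound_ge by (intro mult_le_mono) auto
      then show "rigid_conn + 2 * d \<le> Suc iso_conn" by (simp add: iso_conn_def)
    qed
    then show ?thesis using rk_iso_deg[OF G iso _ w(1)] by fastforce
  qed
  have rkG: "rk G = rk ?F + d"
  proof -
    have "k_connected G (rigid_conn + card {v})"
      by (rule k_connected_le[OF con]) (simp add: iso_conn_def)
    then show ?thesis using rk_avoid_connected[OF G(1), of "{v}"] v by simp
  qed
  \<comment> \<open>A further edge would come from an edge \<open>e\<close> at \<open>v\<close>.
    Adding \<open>e\<close> raises the rank of \<open>?F\<close>, whereas \<open>avoid H {w}\<close>
    has rank at most \<open>rk H - d\<close>, which equals \<open>rk ?F\<close>.\<close>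
  have "avoid H {w} \<subseteq> ?H"
  proof
    fix h assume h: "h \<in> avoid H {w}"
    then obtain e where e: "e \<in> G" "h = \<psi> e" using img by (auto simp: avoid_def)
    show "h \<in> ?H"
    proof (rule ccontr)
      assume "h \<notin> ?H"
      then have eF: "e \<notin> ?F" using e by auto
      then have ve: "v \<in> e" using e by (auto simp: avoid_def)
      have "rk (insert e ?F) \<le> rk (avoid H {w})"
      proof -
        have "rk (insert e ?F) = rk (\<psi> ` insert e ?F)" using rk[of "insert e ?F"] e sub by simp
        also have "\<dots> \<le> rk (avoid H {w})"
          using h e Hw graph_finite[OF graph_avoid[OF G(2)]] by (intro rk_mono) auto
        finally show ?thesis .
      qed
      also have "\<dots> + d \<le> rk H" using rk_add_vertex[OF G(2), of w] degw by simp
      finally have "rk (insert e ?F) \<le> rk ?F" using rk_iso_rk[OF iso] rkG by simp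
      moreover have "rk ?F + 1 \<le> rk (insert e ?F)"
      proof -
        have ge: "graph (insert e ?F)" using graph_subset[OF G(1)] e sub by auto
        have "{f \<in> insert e ?F. v \<in> f} = {e}" using ve by (auto simp: avoid_def)
        then have "deg (insert e ?F) v = 1" by (simp add: deg_def)
        moreover have "avoid (insert e ?F) {v} = ?F" using ve by (auto simp: avoid_def)
        ultimately show ?thesis using rk_add_vertex[OF ge, of v] d_pos by simp
      qed
      ultimately show False by simp
    qed
  qed
  then have eq: "?H = avoid H {w}" using Hw by simp
  have "\<psi> ` {e \<in> G. v \<in> e} = \<psi> ` (G - ?F)"
    by (rule arg_cong[where f = "(`) \<psi>"]) (auto simp: avoid_def)
  also have "\<dots> = H - avoid H {w}" using inj_on_image_set_diff[OF inj _ sub(1), of G] img eq by simp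
  also have "\<dots> = {e \<in> H. w \<in> e}" by (auto simp: avoid_def)
  finally show ?thesis using w(1) by blast
qed

text \<open>\<open>\<phi>\<close> sends \<open>v\<close> to the centre of the image of its star. An
  edge lies in the stars of both its ends, so its image contains the images of both ends; the vertex
  count makes \<open>\<phi>\<close> surjective.\<close>

lemma rk_iso_induced:
  assumes G: "graph G" "graph H" and iso: "rk_iso \<psi> G H" and con: "k_connected G (Suc iso_conn)"
  shows "\<exists>\<phi>. graph_iso \<phi> G H \<and> (\<forall>e\<in>G. \<psi> e = \<phi> ` e)"
proof -
  have inj: "inj_on \<psi> G" and img: "\<psi> ` G = H"
    using iso by (auto simp: rk_iso_def bij_betw_def)
  obtain \<phi> where \<phi>: "\<And>v. v \<in> verts G \<Longrightarrow> \<phi> v \<in> verts H \<and> \<psi> ` {e \<in> G. v \<in> e} = {e \<in> H. \<phi> v \<in> e}"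
    using rk_iso_star[OF assms] by metis
  have inj_phi: "inj_on \<phi> (verts G)"
  proof (rule inj_onI, rule ccontr)
    fix u v assume uv: "u \<in> verts G" "v \<in> verts G" "\<phi> u = \<phi> v" "u \<noteq> v"
    then have "\<psi> ` {e \<in> G. u \<in> e} = \<psi> ` {e \<in> G. v \<in> e}" using \<phi> by simp
    then have star: "{e \<in> G. u \<in> e} = {e \<in> G. v \<in> e}"
      using inj_on_image_eq_iff[OF inj, of "{e \<in> G. u \<in> e}" "{e \<in> G. v \<in> e}"] by auto
    \<comment> \<open>Equal stars at distinct vertices would leave \<open>u\<close> with at most one
      neighbour, contradicting the connectivity.\<close>
    have "nbrs G u \<subseteq> {v}"
    proof
      fix z assume "z \<in> nbrs G u"
      then have "{u, z} \<in> {e \<in> G. u \<in> e}" by (simp add: nbrs_def)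
      then have "v \<in> {u, z}" unfolding star by simp
      then show "z \<in> {v}" using uv by simp
    qed
    then have "deg G u \<le> 1"
      using card_mono[of "{v}" "nbrs G u"] by (simp add: deg_eq_card_nbrs[OF G(1)])
    moreover have "Suc iso_conn \<le> deg G u" by (rule k_connected_deg[OF G(1) con uv(1)])
    ultimately show False using rigid_conn_ge(3) by (simp add: iso_conn_def)
  qed
  have "card (\<phi> ` verts G) = card (verts H)"
    using card_image[OF inj_phi] rk_iso_card_verts[OF G iso k_connected_le[OF con]] by simp
  moreover have "\<phi> ` verts G \<subseteq> verts H" using \<phi> by auto
  ultimately have "\<phi> ` verts G = verts H"
    using finite_verts[OF G(2)] by (intro card_subset_eq) auto
  then have bij: "bij_betw \<phi> (verts G) (verts H)" using inj_phi by (simp add: bij_betw_def)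
  have edge: "\<psi> e = \<phi> ` e" if e: "e \<in> G" for e
  proof -
    obtain u v where uv: "e = {u, v}" "u \<noteq> v" using e G(1) by (auto simp: graph_def card_2_iff)
    then have V: "u \<in> verts G" "v \<in> verts G" using e edge_in_verts by fast+
    have "\<psi> e \<in> \<psi> ` {e \<in> G. u \<in> e}" "\<psi> e \<in> \<psi> ` {e \<in> G. v \<in> e}" using e uv by auto
    then have "\<psi> e \<in> H" "{\<phi> u, \<phi> v} \<subseteq> \<psi> e" using \<phi>[OF V(1)] \<phi>[OF V(2)] by auto
    moreover have "\<phi> u \<noteq> \<phi> v" using inj_phi V uv by (auto simp: inj_on_def)
    moreover have "card (\<psi> e) = 2" using \<open>\<psi> e \<in> H\<close> G(2) by (simp add: graph_def)
    ultimately have "{\<phi> u, \<phi> v} = \<psi> e"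
      by (intro card_subset_eq) (auto intro: card_ge_0_finite)
    then show ?thesis using uv by simp
  qed
  have "{u, v} \<in> G \<longleftrightarrow> {\<phi> u, \<phi> v} \<in> H" if uv: "u \<in> verts G" "v \<in> verts G" for u v
  proof
    assume "{u, v} \<in> G"
    then show "{\<phi> u, \<phi> v} \<in> H" using edge[of "{u, v}"] img by auto
  next
    assume "{\<phi> u, \<phi> v} \<in> H"
    then obtain e where e: "e \<in> G" "\<psi> e = {\<phi> u, \<phi> v}" using img by auto
    then have "\<phi> ` e = \<phi> ` {u, v}" using edge by simp
    moreover have "e \<subseteq> verts G" using e by (auto simp: verts_def)
    ultimately have "e = {u, v}"
      using inj_on_image_eq_iff[OF inj_phi, of e "{u, v}"] uv by simp
    then show "{u, v} \<in> G" using e by simp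
  qed
  then have "graph_iso \<phi> G H" using bij by (simp add: graph_iso_def)
  then show ?thesis using edge by blast
qed

section \<open>The two properties of the family\<close>

lemma lovasz_yemini: "lovasz_yemini M"
proof -
  have "rigid M G" if "graph G" "k_connected G rigid_conn" for G
    using connected_rk[OF that] rank_eq_rk[OF that(1)]
      rank_eq_rk[OF graph_complete[OF finite_verts[OF that(1)]]] by (simp add: rigid_def)
  then show ?thesis unfolding lovasz_yemini_def by blast
qed

lemma whitney: "whitney M"
proof -
  have "reconstructible M G" if "graph G" "k_connected G (Suc iso_conn)" for G
    unfolding reconstructible_def
  proof (intro allI impI)
    fix H \<psi>
    assume "graph H \<and> bij_betw \<psi> G H \<and> (\<forall>F. F \<subseteq> G \<longrightarrow> (M G F \<longleftrightarrow> M H (\<psi> ` F)))"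
    then have H: "graph H" and iso: "rk_iso \<psi> G H" using rk_isoI[OF that(1)] by auto
    show "\<exists>\<phi>. graph_iso \<phi> G H \<and> (\<forall>e\<in>G. \<psi> e = \<phi> ` e)"
      by (rule rk_iso_induced[OF that(1) H iso that(2)])
  qed
  then show ?thesis unfolding whitney_def by blast
qed

end

theorem theorem1p3:
  fixes M :: "'v set set \<Rightarrow> 'v set set \<Rightarrow> bool"
  assumes "graph_matroid_family M"
    and "one_extendable M"
  shows "lovasz_yemini M \<and> whitney M"
proof -
  interpret one_extendable_family M using assms by unfold_locales
  show ?thesis using lovasz_yemini whitney by blast
qed

end
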